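(* Let $\mathcal{A}$ be a dual Banach algebra with a left approximate identity and let $\varphi\in\Delta_{wk^*}(\mathcal{A})$ (that is, $\mathcal{A}$ admits a $wk^*$-continuous character $\varphi$). Then the dual Banach algebra $Tri(\mathcal{A},\mathcal{A},\mathcal{A})$ is not approximately Connes-biprojective.
   Context: A Banach algebra $\mathcal{A}$ is called a dual Banach algebra if there is a closed $\mathcal{A}$-submodule $\mathcal{A}_*$ of $\mathcal{A}^*$ such that $\mathcal{A}=(\mathcal{A}_* )^*$; the $wk^*$-topology on $\mathcal{A}$ is $\sigma(\mathcal{A},\mathcal{A}_* )$. A left approximate identity is a (not necessarily bounded) net $(e_\alpha)$ in $\mathcal{A}$ with $e_\alpha a\to a$ in norm for every $a\in\mathcal{A}$. $\Delta_{wk^*}(\mathcal{A})$ denotes the set of all $wk^*$-continuous characters (nonzero multiplicative linear functionals) on $\mathcal{A}$. $Tri(\mathcal{A},\mathcal{A},\mathcal{A})$ is the Banach algebra of all matrices $\left(\begin{array}{cc} a&x\\0&b\end{array}\right)$ with $a,x,b\in\mathcal{A}$, with the usual matrix operations and norm $\|a\|+\|x\|+\|b\|$. It is a dual Banach algebra with respect to the predual $\mathcal{A}_*\oplus_\infty\mathcal{A}_*\oplus_\infty\mathcal{A}_*$ (entrywise pairing). Approximate Connes-biprojectivity of a dual Banach algebra $\mathcal{B}$ with predual $\mathcal{B}_*$ is defined as follows. For a Banach $\mathcal{B}$-bimodule $E$, the dual $E^*$ is a Banach $\mathcal{B}$-bimodule via $(a\cdot f)(x)=f(x\cdot a)$ and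 $(f\cdot a)(x)=f(a\cdot x)$. The projective tensor product $\mathcal{B}\hat{\otimes}\mathcal{B}$ is a Banach $\mathcal{B}$-bimodule via $a\cdot(b\otimes c)=ab\otimes c$, $(b\otimes c)\cdot a=b\otimes ca$, and $\pi_{\mathcal{B}}:\mathcal{B}\hat{\otimes}\mathcal{B}\to\mathcal{B}$ is determined by $\pi_{\mathcal{B}}(a\otimes b)=ab$. For a Banach $\mathcal{B}$-bimodule $E$, $\sigma wc(E)$ is the closed submodule of all $x\in E$ such that the maps $\mathcal{B}\to E$, $a\mapsto a\cdot x$ and $a\mapsto x\cdot a$, are continuous from the $wk^*$-topology of $\mathcal{B}$ to the weak topology of $E$. The notation $\sigma wc(\mathcal{B}\hat{\otimes}\mathcal{B})^*$ means $\sigma wc((\mathcal{B}\hat{\otimes}\mathcal{B})^* )$. The adjoint $\pi_{\mathcal{B}}^*$ maps $\mathcal{B}_*$ into $\sigma wc(\mathcal{B}\hat{\otimes}\mathcal{B})^*$, and $\pi_{\sigma wc}:(\sigma wc(\mathcal{B}\hat{\otimes}\mathcal{B})^* )^*\to\mathcal{B}=(\mathcal{B}_* )^*$ denotes the adjoint of $\pi_{\mathcal{B}}^*|_{\mathcal{B}_*}$. $\mathcal{B}$ is approximately Connes-biprojective if there exists a (not necessarily bounded) net $(\rho_\alpha)$ of continuous $\mathcal{B}$-bimodule morphisms from $\mathcal{B}$ into $(\sigma wc(\mathcal{B}\hat{\otimes}\mathcal{B})^* )^*$ such that $\pi_{\sigma wc}\circ\rho_\alpha(a)\to a$ in norm for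 every $a\in\mathcal{B}$. *)

theory Defs
  imports "HOL-Analysis.Analysis" "HOL-Library.Poly_Mapping"
begin

text \<open>
  Banach spaces and algebras are complex; a Banach algebra is a type of sort
  \<open>{complex_normed_algebra, banach}\<close> (no unit is assumed). The type \<open>'e cdual\<close> is the Banach space
  dual of \<open>'e\<close>, and \<open>('b, 'c) ptensor\<close> is the projective tensor product. Subspaces of such spaces
  (preduals, the \<open>\<sigma>wc\<close>-part of a module) are sets. The actions of a bimodule are passed as two
  functions \<open>l a x = a \<cdot> x\<close> and \<open>r x a = x \<cdot> a\<close>.
\<close>

section \<open>Complex normed spaces and algebras\<close>

class complex_normed_vector = real_normed_vector +
  fixes scaleC :: "complex \<Rightarrow> 'a \<Rightarrow> 'a"  (infixr \<open>*\<^sub>C\<close> 75)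
  assumes scaleC_add_right: "c *\<^sub>C (x + y) = c *\<^sub>C x + c *\<^sub>C y"
    and scaleC_add_left: "(c + d) *\<^sub>C x = c *\<^sub>C x + d *\<^sub>C x"
    and scaleC_scaleC: "c *\<^sub>C d *\<^sub>C x = (c * d) *\<^sub>C x"
    and scaleC_of_real: "complex_of_real r *\<^sub>C x = r *\<^sub>R x"
    and norm_scaleC: "norm (c *\<^sub>C x) = cmod c * norm x"

class complex_normed_algebra = complex_normed_vector + real_normed_algebra +
  assumes scaleC_mult_left: "(c *\<^sub>C x) * y = c *\<^sub>C (x * y)"
    and scaleC_mult_right: "x * (c *\<^sub>C y) = c *\<^sub>C (x * y)"

lemma scaleC_one [simp]: "1 *\<^sub>C (x :: 'a :: complex_normed_vector) = x"
  using scaleC_of_real[of 1 x] by simp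

lemma scaleC_zero_left [simp]: "0 *\<^sub>C (x :: 'a :: complex_normed_vector) = 0"
  using scaleC_of_real[of 0 x] by simp

lemma scaleC_zero_right [simp]: "c *\<^sub>C (0 :: 'a :: complex_normed_vector) = 0"
  using scaleC_add_right[of c 0 0] by simp

lemma scaleC_minus_right [simp]: "c *\<^sub>C (- x :: 'a :: complex_normed_vector) = - (c *\<^sub>C x)"
  using scaleC_add_right[of c x "- x"] by (simp add: eq_neg_iff_add_eq_0 add.commute)

lemma scaleC_diff_right: "c *\<^sub>C (x - y :: 'a :: complex_normed_vector) = c *\<^sub>C x - c *\<^sub>C y"
  using scaleC_add_right[of c x "- y"] by simp

lemma scaleC_sum_right: "c *\<^sub>C (sum f S :: 'a :: complex_normed_vector) = (\<Sum>i\<in>S. c *\<^sub>C f i)"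
  by (induction S rule: infinite_finite_induct) (auto simp: scaleC_add_right)

instantiation complex :: complex_normed_algebra
begin

definition scaleC_complex :: "complex \<Rightarrow> complex \<Rightarrow> complex"
  where "scaleC_complex = (*)"

instance
  by standard (auto simp: scaleC_complex_def algebra_simps norm_mult scaleR_conv_of_real)

end

definition csubspace :: "'a::complex_normed_vector set \<Rightarrow> bool" where
  "csubspace S \<longleftrightarrow> 0 \<in> S \<and> (\<forall>x\<in>S. \<forall>y\<in>S. x + y \<in> S) \<and> (\<forall>c. \<forall>x\<in>S. c *\<^sub>C x \<in> S)"

definition bounded_clinear :: "('a::complex_normed_vector \<Rightarrow> 'b::complex_normed_vector) \<Rightarrow> bool" where
  "bounded_clinear f \<longleftrightarrow> bounded_linear f \<and> (\<forall>c x. f (c *\<^sub>C x) = c *\<^sub>C f x)"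

definition bounded_cbilinear ::
    "('a::complex_normed_vector \<Rightarrow> 'b::complex_normed_vector \<Rightarrow> 'c::complex_normed_vector) \<Rightarrow> bool" where
  "bounded_cbilinear \<beta> \<longleftrightarrow> bounded_bilinear \<beta> \<and>
     (\<forall>c x y. \<beta> (c *\<^sub>C x) y = c *\<^sub>C \<beta> x y) \<and> (\<forall>c x y. \<beta> x (c *\<^sub>C y) = c *\<^sub>C \<beta> x y)"

lemma bounded_clinear_scaleC: "bounded_clinear (\<lambda>x. c *\<^sub>C x)"
proof -
  have "c *\<^sub>C r *\<^sub>R x = r *\<^sub>R c *\<^sub>C x" for r and x :: 'a
    by (simp flip: scaleC_of_real add: scaleC_scaleC mult.commute)
  then have "bounded_linear (\<lambda>x::'a. c *\<^sub>C x)"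
    by (intro bounded_linear_intro[where K="cmod c"]) (auto simp: scaleC_add_right norm_scaleC)
  then show ?thesis
    by (simp add: bounded_clinear_def scaleC_scaleC mult.commute)
qed

lemma bounded_clinear_compose:
  "bounded_clinear f \<Longrightarrow> bounded_clinear g \<Longrightarrow> bounded_clinear (\<lambda>x. f (g x))"
  by (auto simp: bounded_clinear_def intro: bounded_linear_compose)


section \<open>The dual space\<close>

typedef (overloaded) 'a cdual = "{f :: 'a::complex_normed_vector \<Rightarrow>\<^sub>L complex. \<forall>c x. f (c *\<^sub>C x) = c * f x}"
  morphisms blinfun_of_cdual Abs_cdual
  by (intro exI[of _ 0]) simp

setup_lifting type_definition_cdual

instantiation cdual :: (complex_normed_vector) complex_normed_vector
begin

lift_definition zero_cdual :: "'a cdual" is 0 by simp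
lift_definition plus_cdual :: "'a cdual \<Rightarrow> 'a cdual \<Rightarrow> 'a cdual" is "(+)"
  by (simp add: blinfun.add_left algebra_simps)
lift_definition minus_cdual :: "'a cdual \<Rightarrow> 'a cdual \<Rightarrow> 'a cdual" is "(-)"
  by (simp add: blinfun.diff_left algebra_simps)
lift_definition uminus_cdual :: "'a cdual \<Rightarrow> 'a cdual" is "uminus"
  by (simp add: blinfun.minus_left)
lift_definition scaleR_cdual :: "real \<Rightarrow> 'a cdual \<Rightarrow> 'a cdual" is "(*\<^sub>R)"
  by (simp add: blinfun.scaleR_left algebra_simps)
lift_definition scaleC_cdual :: "complex \<Rightarrow> 'a cdual \<Rightarrow> 'a cdual"
  is "\<lambda>c f. blinfun_compose (blinfun_mult_right c) f"
  by (simp add: algebra_simps)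
lift_definition norm_cdual :: "'a cdual \<Rightarrow> real" is norm .

definition dist_cdual :: "'a cdual \<Rightarrow> 'a cdual \<Rightarrow> real"
  where "dist_cdual f g = norm (f - g)"
definition sgn_cdual :: "'a cdual \<Rightarrow> 'a cdual"
  where "sgn_cdual f = scaleR (inverse (norm f)) f"
definition uniformity_cdual :: "('a cdual \<times> 'a cdual) filter"
  where "uniformity_cdual = (INF e\<in>{0 <..}. principal {(x, y). dist x y < e})"
definition open_cdual :: "'a cdual set \<Rightarrow> bool"
  where "open_cdual S = (\<forall>x\<in>S. \<forall>\<^sub>F (x', y) in uniformity. x' = x \<longrightarrow> y \<in> S)"

instance
proof
  fix f g h :: "'a cdual" and r s :: real and c d :: complex
  show "f + g + h = f + (g + h)" "f + g = g + f" "0 + f = f" "- f + f = 0" "f - g = f + - g"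
    "r *\<^sub>R (f + g) = r *\<^sub>R f + r *\<^sub>R g" "(r + s) *\<^sub>R f = r *\<^sub>R f + s *\<^sub>R f"
    "r *\<^sub>R s *\<^sub>R f = (r * s) *\<^sub>R f" "1 *\<^sub>R f = f"
    "norm f = 0 \<longleftrightarrow> f = 0" "norm (f + g) \<le> norm f + norm g" "norm (r *\<^sub>R f) = \<bar>r\<bar> * norm f"
    by (transfer, auto simp: algebra_simps norm_triangle_ineq)+
  show "c *\<^sub>C (f + g) = c *\<^sub>C f + c *\<^sub>C g" "(c + d) *\<^sub>C f = c *\<^sub>C f + d *\<^sub>C f"
    "c *\<^sub>C d *\<^sub>C f = (c * d) *\<^sub>C f" "complex_of_real r *\<^sub>C f = r *\<^sub>R f"
    by (transfer, rule blinfun_eqI,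
        simp add: blinfun.add_left blinfun.scaleR_left algebra_simps scaleR_conv_of_real)+
  show "norm (c *\<^sub>C f) = cmod c * norm f"
  proof transfer
    fix c and f :: "'a \<Rightarrow>\<^sub>L complex"
    have "onorm (\<lambda>x. c * blinfun_apply f x) \<le> cmod c * onorm (blinfun_apply f)"
      using onorm[OF blinfun.bounded_linear_right, of f]
      by (intro onorm_bound)
        (auto simp: norm_mult mult.assoc intro!: mult_left_mono mult_nonneg_nonneg onorm_pos_le
          blinfun.bounded_linear_right)
    moreover have "cmod c * onorm (blinfun_apply f) \<le> onorm (\<lambda>x. c * blinfun_apply f x)"
    proof (cases "c = 0")
      case False
      have "norm (blinfun_apply f x) \<le> onorm (\<lambda>x. c * blinfun_apply f x) / cmod c * norm x" for x
      proof -
        have "cmod (c * blinfun_apply f x) \<le> onorm (\<lambda>x. c * blinfun_apply f x) * norm x"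
          by (intro onorm bounded_linear_const_mult blinfun.bounded_linear_right)
        then show ?thesis using False by (simp add: field_simps norm_mult)
      qed
      then have "onorm (blinfun_apply f) \<le> onorm (\<lambda>x. c * blinfun_apply f x) / cmod c"
        by (intro onorm_bound)
          (auto intro!: divide_nonneg_nonneg onorm_pos_le bounded_linear_const_mult
            blinfun.bounded_linear_right)
      then show ?thesis using False by (simp add: field_simps)
    qed (simp add: onorm_zero)
    ultimately show "norm (blinfun_compose (blinfun_mult_right c) f) = cmod c * norm f"
      by (simp add: norm_blinfun.rep_eq fun_eq_iff[THEN iffD2, OF allI,
            of "blinfun_apply (blinfun_compose (blinfun_mult_right c) f)" "\<lambda>x. c * blinfun_apply f x"])
  qed
qed (fact dist_cdual_def sgn_cdual_def uniformity_cdual_def open_cdual_def)+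

end

instance cdual :: (complex_normed_vector) banach
proof
  fix X :: "nat \<Rightarrow> 'a cdual"
  assume "Cauchy X"
  have di: "dist (blinfun_of_cdual f) (blinfun_of_cdual g) = dist f g" for f g :: "'a cdual"
    by (simp add: dist_norm norm_cdual.rep_eq minus_cdual.rep_eq)
  have "Cauchy (\<lambda>n. blinfun_of_cdual (X n))"
    using \<open>Cauchy X\<close> by (simp add: Cauchy_def di)
  then obtain g where g: "(\<lambda>n. blinfun_of_cdual (X n)) \<longlonglongrightarrow> g"
    using Cauchy_convergent_iff convergent_def by blast
  have "blinfun_apply g (c *\<^sub>C x) = c * blinfun_apply g x" for c x
  proof (rule LIMSEQ_unique)
    show "(\<lambda>n. blinfun_of_cdual (X n) (c *\<^sub>C x)) \<longlonglongrightarrow> g (c *\<^sub>C x)"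
      by (intro tendsto_intros g)
    have "(\<lambda>n. c * blinfun_of_cdual (X n) x) \<longlonglongrightarrow> c * g x"
      by (intro tendsto_intros g)
    moreover have "blinfun_of_cdual (X n) (c *\<^sub>C x) = c * blinfun_of_cdual (X n) x" for n
      using blinfun_of_cdual[of "X n"] by simp
    ultimately show "(\<lambda>n. blinfun_of_cdual (X n) (c *\<^sub>C x)) \<longlonglongrightarrow> c * g x"
      by simp
  qed
  then have "blinfun_of_cdual (Abs_cdual g) = g"
    by (intro Abs_cdual_inverse) simp
  then have "X \<longlonglongrightarrow> Abs_cdual g"
    using g by (simp add: tendsto_iff flip: di)
  then show "convergent X" by (auto simp: convergent_def)
qed

definition cdual_apply :: "'a::complex_normed_vector cdual \<Rightarrow> 'a \<Rightarrow> complex" where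
  "cdual_apply f = blinfun_apply (blinfun_of_cdual f)"

declare [[coercion cdual_apply]]

definition to_cdual :: "('a::complex_normed_vector \<Rightarrow> complex) \<Rightarrow> 'a cdual" where
  "to_cdual f = Abs_cdual (Blinfun f)"

lemma to_cdual_apply: "bounded_clinear f \<Longrightarrow> cdual_apply (to_cdual f) = f"
  by (simp add: to_cdual_def cdual_apply_def bounded_clinear_def Abs_cdual_inverse
      bounded_linear_Blinfun_apply scaleC_complex_def)

lemma bounded_clinear_cdual_apply: "bounded_clinear (cdual_apply f)"
  using blinfun_of_cdual[of f]
  by (simp add: cdual_apply_def bounded_clinear_def blinfun.bounded_linear_right scaleC_complex_def)

lemma cdual_eqI: "(\<And>x. cdual_apply f x = cdual_apply g x) \<Longrightarrow> f = g"
  by (simp add: cdual_apply_def blinfun_of_cdual_inject[symmetric] blinfun_eqI)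

section \<open>The projective tensor product\<close>

text \<open>
  The algebraic tensor product is the free complex vector space on pairs modulo the subspace
  \<open>tensor_relations\<close> generated by the bilinearity relations. The projective seminorm of \<open>u\<close> is the infimum
  of \<open>\<Sum>\<^sub>i \<bar>c\<^sub>i\<bar> \<parallel>x\<^sub>i\<parallel> \<parallel>y\<^sub>i\<parallel>\<close> over all representatives \<open>\<Sum>\<^sub>i c\<^sub>i (x\<^sub>i, y\<^sub>i)\<close> of the class of \<open>u\<close>, and \<open>ptensor\<close> is
  the completion: Cauchy sequences modulo null sequences. Passing from the free space to the completion
  in one step also factors out \<open>tensor_relations\<close>, since the seminorm vanishes there.
\<close>

type_synonym ('b, 'c) free_tensor = "('b \<times> 'c) \<Rightarrow>\<^sub>0 complex"

definition free_scale :: "complex \<Rightarrow> ('b, 'c) free_tensor \<Rightarrow> ('b, 'c) free_tensor" where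
  "free_scale c u = Poly_Mapping.map ((*) c) u"

inductive_set tensor_relations ::
    "('b::complex_normed_vector, 'c::complex_normed_vector) free_tensor set" where
  zero: "0 \<in> tensor_relations"
| add: "u \<in> tensor_relations \<Longrightarrow> v \<in> tensor_relations \<Longrightarrow> u + v \<in> tensor_relations"
| scale: "u \<in> tensor_relations \<Longrightarrow> free_scale c u \<in> tensor_relations"
| add_left: "Poly_Mapping.single (x + x', y) 1 - Poly_Mapping.single (x, y) 1
    - Poly_Mapping.single (x', y) 1 \<in> tensor_relations"
| add_right: "Poly_Mapping.single (x, y + y') 1 - Poly_Mapping.single (x, y) 1
    - Poly_Mapping.single (x, y') 1 \<in> tensor_relations"
| scale_left: "Poly_Mapping.single (c *\<^sub>C x, y) 1 - Poly_Mapping.single (x, y) c \<in> tensor_relations"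
| scale_right: "Poly_Mapping.single (x, c *\<^sub>C y) 1 - Poly_Mapping.single (x, y) c \<in> tensor_relations"

definition free_cost :: "('b::complex_normed_vector, 'c::complex_normed_vector) free_tensor \<Rightarrow> real" where
  "free_cost u = (\<Sum>k\<in>Poly_Mapping.keys u. cmod (Poly_Mapping.lookup u k) * (norm (fst k) * norm (snd k)))"

definition proj_norm :: "('b::complex_normed_vector, 'c::complex_normed_vector) free_tensor \<Rightarrow> real" where
  "proj_norm u = (INF v\<in>{v. u - v \<in> tensor_relations}. free_cost v)"

lemma lookup_free_scale [simp]: "Poly_Mapping.lookup (free_scale c u) k = c * Poly_Mapping.lookup u k"
  by (simp add: free_scale_def Poly_Mapping.map.rep_eq when_def)

lemma free_scale_simps:
  "free_scale c (u + v) = free_scale c u + free_scale c v"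
  "free_scale c (u - v) = free_scale c u - free_scale c v"
  "free_scale (c + d) u = free_scale c u + free_scale d u"
  "free_scale c (free_scale d u) = free_scale (c * d) u"
  "free_scale 1 u = u" "free_scale (- 1) u = - u" "free_scale 0 u = 0" "free_scale c 0 = 0"
  by (auto intro!: poly_mapping_eqI simp: lookup_add lookup_minus algebra_simps)

lemma keys_free_scale: "Poly_Mapping.keys (free_scale c u) \<subseteq> Poly_Mapping.keys u"
  by (auto simp: in_keys_iff)

lemma tensor_relations_uminus: "u \<in> tensor_relations \<Longrightarrow> - u \<in> tensor_relations"
  using tensor_relations.scale[of u "- 1"] by (simp add: free_scale_simps)

lemma free_cost_superset:
  assumes "finite S" "Poly_Mapping.keys u \<subseteq> S"
  shows "free_cost u = (\<Sum>k\<in>S. cmod (Poly_Mapping.lookup u k) * (norm (fst k) * norm (snd k)))"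
  unfolding free_cost_def using assms by (intro sum.mono_neutral_left) (auto simp: in_keys_iff)

lemma free_cost_nonneg: "0 \<le> free_cost u"
  unfolding free_cost_def by (intro sum_nonneg) auto

lemma free_cost_add: "free_cost (u + v) \<le> free_cost u + free_cost v"
proof -
  let ?S = "Poly_Mapping.keys u \<union> Poly_Mapping.keys v"
  have "free_cost (u + v) = (\<Sum>k\<in>?S. cmod (Poly_Mapping.lookup (u + v) k) * (norm (fst k) * norm (snd k)))"
    by (rule free_cost_superset) (use keys_add[of u v] in auto)
  also have "\<dots> \<le> (\<Sum>k\<in>?S. cmod (Poly_Mapping.lookup u k) * (norm (fst k) * norm (snd k))
      + cmod (Poly_Mapping.lookup v k) * (norm (fst k) * norm (snd k)))"
    by (intro sum_mono) (auto simp: lookup_add simp flip: distrib_right intro!: mult_right_mono norm_triangle_ineq)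
  also have "\<dots> = free_cost u + free_cost v"
    by (simp add: sum.distrib free_cost_superset[of ?S])
  finally show ?thesis .
qed

lemma free_cost_scale: "free_cost (free_scale c u) = cmod c * free_cost u"
  by (subst free_cost_superset[of "Poly_Mapping.keys u"])
    (use keys_free_scale[of c u] in \<open>auto simp: free_cost_def sum_distrib_left norm_mult mult.assoc\<close>)

lemma proj_norm_bdd: "bdd_below (free_cost ` {v. u - v \<in> tensor_relations})"
  using free_cost_nonneg by (auto intro!: bdd_belowI[of _ 0])

lemma proj_norm_nonempty: "{v. u - v \<in> tensor_relations} \<noteq> {}"
  using tensor_relations.zero by (auto intro!: exI[of _ u])

lemma proj_norm_le: "u - v \<in> tensor_relations \<Longrightarrow> proj_norm u \<le> free_cost v"
  unfolding proj_norm_def by (intro cINF_lower[OF proj_norm_bdd]) auto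

lemma proj_norm_nonneg: "0 \<le> proj_norm u"
  unfolding proj_norm_def by (intro cINF_greatest[OF proj_norm_nonempty]) (auto simp: free_cost_nonneg)

lemma proj_norm_approx:
  assumes "0 < e"
  obtains v where "u - v \<in> tensor_relations" "free_cost v < proj_norm u + e"
proof -
  have "(INF v\<in>{v. u - v \<in> tensor_relations}. free_cost v) < proj_norm u + e"
    using assms by (simp add: proj_norm_def)
  then show ?thesis
    using that by (subst (asm) cINF_less_iff[OF proj_norm_nonempty proj_norm_bdd]) auto
qed

lemma proj_norm_add: "proj_norm (u + v) \<le> proj_norm u + proj_norm v"
proof (rule field_le_epsilon)
  fix e :: real assume "0 < e"
  then have "0 < e / 2" by simp
  obtain u' where u': "u - u' \<in> tensor_relations" "free_cost u' < proj_norm u + e / 2"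
    using proj_norm_approx[OF \<open>0 < e / 2\<close>] by blast
  obtain v' where v': "v - v' \<in> tensor_relations" "free_cost v' < proj_norm v + e / 2"
    using proj_norm_approx[OF \<open>0 < e / 2\<close>] by blast
  have "u + v - (u' + v') \<in> tensor_relations"
    using tensor_relations.add[OF u'(1) v'(1)] by (simp add: algebra_simps)
  then have "proj_norm (u + v) \<le> free_cost (u' + v')" by (rule proj_norm_le)
  also have "\<dots> \<le> free_cost u' + free_cost v'" by (rule free_cost_add)
  finally show "proj_norm (u + v) \<le> proj_norm u + proj_norm v + e"
    using u' v' by simp
qed

lemma scale_bound: "0 < e \<Longrightarrow> 0 \<le> a \<Longrightarrow> a * (e / (a + 1)) < (e :: real)"
  by (simp add: pos_divide_less_eq algebra_simps)

lemma proj_norm_scale_le: "proj_norm (free_scale c u) \<le> cmod c * proj_norm u"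
proof (rule field_le_epsilon)
  fix e :: real assume "0 < e"
  then have "0 < e / (cmod c + 1)" by (simp add: add_nonneg_pos)
  then obtain v where v: "u - v \<in> tensor_relations" "free_cost v < proj_norm u + e / (cmod c + 1)"
    using proj_norm_approx by blast
  have "proj_norm (free_scale c u) \<le> free_cost (free_scale c v)"
    using tensor_relations.scale[OF v(1), of c] by (intro proj_norm_le) (simp add: free_scale_simps)
  also have "\<dots> \<le> cmod c * (proj_norm u + e / (cmod c + 1))"
    using v(2) by (simp add: free_cost_scale mult_left_mono)
  also have "\<dots> \<le> cmod c * proj_norm u + e"
    using scale_bound[of e "cmod c"] \<open>0 < e\<close> by (simp add: distrib_left)
  finally show "proj_norm (free_scale c u) \<le> cmod c * proj_norm u + e" .
qed

lemma proj_norm_scale: "proj_norm (free_scale c u) = cmod c * proj_norm u"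
proof (cases "c = 0")
  case True
  have "proj_norm (0 :: ('a, 'b) free_tensor) \<le> free_cost (0 :: ('a, 'b) free_tensor)" by (intro proj_norm_le) (simp add: tensor_relations.zero)
  then show ?thesis using True proj_norm_nonneg[of "0 :: ('a, 'b) free_tensor"]
    by (simp add: free_scale_simps free_cost_def)
next
  case False
  have "proj_norm u \<le> cmod (inverse c) * proj_norm (free_scale c u)"
    using proj_norm_scale_le[of "inverse c" "free_scale c u"] False by (simp add: free_scale_simps)
  then have "cmod c * proj_norm u \<le> proj_norm (free_scale c u)"
    using False by (simp add: norm_divide field_simps)
  then show ?thesis using proj_norm_scale_le[of c u] by simp
qed

lemma proj_norm_uminus: "proj_norm (- u) = proj_norm u"
  using proj_norm_scale[of "- 1" u] by (simp add: free_scale_simps)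

lemma proj_norm_minus_commute: "proj_norm (u - v) = proj_norm (v - u)"
  using proj_norm_uminus[of "u - v"] by simp

lemma proj_norm_zero [simp]: "proj_norm 0 = 0"
  using proj_norm_scale[of 0 0] by (simp add: free_scale_simps)

lemma proj_norm_triangle: "proj_norm (u - w) \<le> proj_norm (u - v) + proj_norm (v - w)"
  using proj_norm_add[of "u - v" "v - w"] by simp

lemma proj_norm_reverse: "\<bar>proj_norm u - proj_norm v\<bar> \<le> proj_norm (u - v)"
  using proj_norm_add[of "u - v" v] proj_norm_add[of "v - u" u] proj_norm_minus_commute[of u v]
  by simp

lemma proj_norm_relation: "u \<in> tensor_relations \<Longrightarrow> proj_norm u = 0"
  using proj_norm_le[of u 0] proj_norm_nonneg[of u] by (simp add: free_cost_def)

definition proj_Cauchy :: "(nat \<Rightarrow> ('b::complex_normed_vector, 'c::complex_normed_vector) free_tensor) \<Rightarrow> bool" where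
  "proj_Cauchy X \<longleftrightarrow> (\<forall>e>0. \<exists>N. \<forall>m\<ge>N. \<forall>n\<ge>N. proj_norm (X m - X n) < e)"

definition ptensor_rel ::
    "(nat \<Rightarrow> ('b::complex_normed_vector, 'c::complex_normed_vector) free_tensor) \<Rightarrow>
     (nat \<Rightarrow> ('b, 'c) free_tensor) \<Rightarrow> bool" where
  "ptensor_rel X Y \<longleftrightarrow> proj_Cauchy X \<and> proj_Cauchy Y \<and> (\<lambda>n. proj_norm (X n - Y n)) \<longlonglongrightarrow> 0"

lemma proj_Cauchy_const: "proj_Cauchy (\<lambda>n. u)"
  by (auto simp: proj_Cauchy_def)

lemma proj_Cauchy_add:
  assumes "proj_Cauchy X" "proj_Cauchy Y" shows "proj_Cauchy (\<lambda>n. X n + Y n)"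
  unfolding proj_Cauchy_def
proof (intro allI impI)
  fix e :: real assume "0 < e"
  then have "0 < e / 2" by simp
  obtain M where M: "\<forall>m\<ge>M. \<forall>n\<ge>M. proj_norm (X m - X n) < e / 2"
    using assms(1) \<open>0 < e / 2\<close> unfolding proj_Cauchy_def by blast
  obtain N where N: "\<forall>m\<ge>N. \<forall>n\<ge>N. proj_norm (Y m - Y n) < e / 2"
    using assms(2) \<open>0 < e / 2\<close> unfolding proj_Cauchy_def by blast
  have "proj_norm (X m + Y m - (X n + Y n)) < e" if "m \<ge> max M N" "n \<ge> max M N" for m n
  proof -
    have "proj_norm (X m + Y m - (X n + Y n)) \<le> proj_norm (X m - X n) + proj_norm (Y m - Y n)"
      using proj_norm_add[of "X m - X n" "Y m - Y n"] by (simp add: algebra_simps)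
    moreover have "proj_norm (X m - X n) < e / 2" "proj_norm (Y m - Y n) < e / 2"
      using M N that by auto
    ultimately show ?thesis by simp
  qed
  then show "\<exists>N. \<forall>m\<ge>N. \<forall>n\<ge>N. proj_norm (X m + Y m - (X n + Y n)) < e" by blast
qed

lemma proj_Cauchy_scale:
  assumes "proj_Cauchy X" shows "proj_Cauchy (\<lambda>n. free_scale c (X n))"
  unfolding proj_Cauchy_def
proof (intro allI impI)
  fix e :: real assume "0 < e"
  then have e: "0 < e / (cmod c + 1)" by (simp add: add_nonneg_pos)
  obtain N where N: "\<forall>m\<ge>N. \<forall>n\<ge>N. proj_norm (X m - X n) < e / (cmod c + 1)"
    using assms e unfolding proj_Cauchy_def by blast
  have "proj_norm (free_scale c (X m) - free_scale c (X n)) < e" if "m \<ge> N" "n \<ge> N" for m n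
  proof -
    have "proj_norm (free_scale c (X m) - free_scale c (X n)) = cmod c * proj_norm (X m - X n)"
      by (simp add: proj_norm_scale flip: free_scale_simps)
    also have "\<dots> \<le> cmod c * (e / (cmod c + 1))"
      using N that by (intro mult_left_mono) (auto simp: less_imp_le)
    also have "\<dots> < e" using \<open>0 < e\<close> by (intro scale_bound) auto
    finally show ?thesis .
  qed
  then show "\<exists>N. \<forall>m\<ge>N. \<forall>n\<ge>N. proj_norm (free_scale c (X m) - free_scale c (X n)) < e" by blast
qed

lemma proj_Cauchy_uminus: "proj_Cauchy X \<Longrightarrow> proj_Cauchy (\<lambda>n. - X n)"
  using proj_Cauchy_scale[of X "- 1"] by (simp add: free_scale_simps)

lemma proj_Cauchy_minus: "proj_Cauchy X \<Longrightarrow> proj_Cauchy Y \<Longrightarrow> proj_Cauchy (\<lambda>n. X n - Y n)"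
  using proj_Cauchy_add[OF _ proj_Cauchy_uminus, of X Y] by simp

lemma proj_Cauchy_norm:
  assumes "proj_Cauchy X" shows "convergent (\<lambda>n. proj_norm (X n))"
proof -
  have "Cauchy (\<lambda>n. proj_norm (X n))"
    using assms proj_norm_reverse unfolding proj_Cauchy_def Cauchy_def dist_real_def
    by (meson order_le_less_trans)
  then show ?thesis by (simp add: Cauchy_convergent_iff)
qed

lemma proj_norm_tendsto_0I:
  assumes "Y \<longlonglongrightarrow> 0" "\<And>n. proj_norm (X n) \<le> Y n"
  shows "(\<lambda>n. proj_norm (X n)) \<longlonglongrightarrow> 0"
  by (rule tendsto_sandwich[OF _ _ tendsto_const assms(1)]) (auto simp: assms proj_norm_nonneg)

lemma ptensor_rel_norm:
  assumes "ptensor_rel X Y" shows "lim (\<lambda>n. proj_norm (X n)) = lim (\<lambda>n. proj_norm (Y n))"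
proof -
  have "(\<lambda>n. proj_norm (X n) - proj_norm (Y n)) \<longlonglongrightarrow> 0"
  proof (rule Lim_null_comparison)
    show "\<forall>\<^sub>F n in sequentially. norm (proj_norm (X n) - proj_norm (Y n)) \<le> proj_norm (X n - Y n)"
      by (simp add: proj_norm_reverse)
    show "(\<lambda>n. proj_norm (X n - Y n)) \<longlonglongrightarrow> 0"
      using assms by (simp add: ptensor_rel_def)
  qed
  moreover have "(\<lambda>n. proj_norm (Y n)) \<longlonglongrightarrow> lim (\<lambda>n. proj_norm (Y n))"
    using assms by (simp add: ptensor_rel_def proj_Cauchy_norm flip: convergent_LIMSEQ_iff)
  ultimately have "(\<lambda>n. proj_norm (X n)) \<longlonglongrightarrow> lim (\<lambda>n. proj_norm (Y n))"
    using tendsto_add by fastforce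
  then show ?thesis by (rule limI)
qed

quotient_type (overloaded) ('b, 'c) ptensor =
  "nat \<Rightarrow> ('b::complex_normed_vector, 'c::complex_normed_vector) free_tensor" / partial: ptensor_rel
proof (rule part_equivpI)
  show "\<exists>x :: nat \<Rightarrow> ('b, 'c) free_tensor. ptensor_rel x x"
    by (auto simp: ptensor_rel_def intro: proj_Cauchy_const)
  show "symp (ptensor_rel :: _ \<Rightarrow> (nat \<Rightarrow> ('b, 'c) free_tensor) \<Rightarrow> bool)"
    by (auto simp: symp_def ptensor_rel_def proj_norm_minus_commute)
  show "transp (ptensor_rel :: _ \<Rightarrow> (nat \<Rightarrow> ('b, 'c) free_tensor) \<Rightarrow> bool)"
  proof (rule transpI)
    fix X Y Z :: "nat \<Rightarrow> ('b, 'c) free_tensor"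
    assume "ptensor_rel X Y" "ptensor_rel Y Z"
    then show "ptensor_rel X Z"
      using proj_norm_tendsto_0I[of "\<lambda>n. proj_norm (X n - Y n) + proj_norm (Y n - Z n)" "\<lambda>n. X n - Z n"]
      by (auto simp: ptensor_rel_def proj_norm_triangle dest: tendsto_add[of _ 0 _ _ 0])
  qed
qed

instantiation ptensor :: (complex_normed_vector, complex_normed_vector) complex_normed_vector
begin

lift_definition zero_ptensor :: "('a, 'b) ptensor" is "\<lambda>n. 0"
  by (simp add: ptensor_rel_def proj_Cauchy_const)

lift_definition plus_ptensor :: "('a, 'b) ptensor \<Rightarrow> ('a, 'b) ptensor \<Rightarrow> ('a, 'b) ptensor"
  is "\<lambda>X Y n. X n + Y n"
proof -
  fix X X' Y Y' :: "nat \<Rightarrow> ('a, 'b) free_tensor"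
  assume *: "ptensor_rel X X'" "ptensor_rel Y Y'"
  have "proj_norm (X n + Y n - (X' n + Y' n)) \<le> proj_norm (X n - X' n) + proj_norm (Y n - Y' n)" for n
    using proj_norm_add[of "X n - X' n" "Y n - Y' n"] by (simp add: algebra_simps)
  then show "ptensor_rel (\<lambda>n. X n + Y n) (\<lambda>n. X' n + Y' n)"
    using * proj_norm_tendsto_0I[of "\<lambda>n. proj_norm (X n - X' n) + proj_norm (Y n - Y' n)"
        "\<lambda>n. X n + Y n - (X' n + Y' n)"]
    by (auto simp: ptensor_rel_def proj_Cauchy_add dest: tendsto_add[of _ 0 _ _ 0])
qed

lift_definition scaleC_ptensor :: "complex \<Rightarrow> ('a, 'b) ptensor \<Rightarrow> ('a, 'b) ptensor"
  is "\<lambda>c X n. free_scale c (X n)"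
proof -
  fix c and X X' :: "nat \<Rightarrow> ('a, 'b) free_tensor"
  assume *: "ptensor_rel X X'"
  then have "(\<lambda>n. cmod c * proj_norm (X n - X' n)) \<longlonglongrightarrow> cmod c * 0"
    by (intro tendsto_intros) (simp add: ptensor_rel_def)
  then show "ptensor_rel (\<lambda>n. free_scale c (X n)) (\<lambda>n. free_scale c (X' n))"
    using * by (simp add: ptensor_rel_def proj_Cauchy_scale proj_norm_scale flip: free_scale_simps)
qed

lift_definition norm_ptensor :: "('a, 'b) ptensor \<Rightarrow> real" is "\<lambda>X. lim (\<lambda>n. proj_norm (X n))"
  by (rule ptensor_rel_norm)

definition uminus_ptensor :: "('a, 'b) ptensor \<Rightarrow> ('a, 'b) ptensor"
  where "uminus_ptensor T = scaleC (- 1) T"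
definition minus_ptensor :: "('a, 'b) ptensor \<Rightarrow> ('a, 'b) ptensor \<Rightarrow> ('a, 'b) ptensor"
  where "minus_ptensor S T = S + - T"
definition scaleR_ptensor :: "real \<Rightarrow> ('a, 'b) ptensor \<Rightarrow> ('a, 'b) ptensor"
  where "scaleR_ptensor r T = scaleC (complex_of_real r) T"
definition dist_ptensor :: "('a, 'b) ptensor \<Rightarrow> ('a, 'b) ptensor \<Rightarrow> real"
  where "dist_ptensor S T = norm (S - T)"
definition sgn_ptensor :: "('a, 'b) ptensor \<Rightarrow> ('a, 'b) ptensor"
  where "sgn_ptensor T = scaleR (inverse (norm T)) T"
definition uniformity_ptensor :: "(('a, 'b) ptensor \<times> ('a, 'b) ptensor) filter"
  where "uniformity_ptensor = (INF e\<in>{0 <..}. principal {(x, y). dist x y < e})"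
definition open_ptensor :: "('a, 'b) ptensor set \<Rightarrow> bool"
  where "open_ptensor S = (\<forall>x\<in>S. \<forall>\<^sub>F (x', y) in uniformity. x' = x \<longrightarrow> y \<in> S)"

instance
proof
  fix f g h :: "('a, 'b) ptensor" and r s :: real and c d :: complex
  show 1: "f + g + h = f + (g + h)" "f + g = g + f" "0 + f = f"
    by (transfer; auto simp: ptensor_rel_def algebra_simps intro!: proj_Cauchy_add proj_Cauchy_const)+
  have inv: "(- 1) *\<^sub>C f + f = 0"
    by transfer
      (auto simp: ptensor_rel_def free_scale_simps intro!: proj_Cauchy_add proj_Cauchy_const proj_Cauchy_uminus)
  then show "- f + f = 0" by (simp add: uminus_ptensor_def)
  show "f - g = f + - g" by (simp add: minus_ptensor_def)
  have C: "c *\<^sub>C (f + g) = c *\<^sub>C f + c *\<^sub>C g" "(c + d) *\<^sub>C f = c *\<^sub>C f + d *\<^sub>C f"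
    "c *\<^sub>C d *\<^sub>C f = (c * d) *\<^sub>C f" "1 *\<^sub>C f = f"
    for c d and f g :: "('a, 'b) ptensor"
    by (transfer; auto simp: ptensor_rel_def free_scale_simps intro!: proj_Cauchy_add proj_Cauchy_scale)+
  show "c *\<^sub>C (f + g) = c *\<^sub>C f + c *\<^sub>C g" "(c + d) *\<^sub>C f = c *\<^sub>C f + d *\<^sub>C f"
    "c *\<^sub>C d *\<^sub>C f = (c * d) *\<^sub>C f" by (fact C)+
  show "r *\<^sub>R (f + g) = r *\<^sub>R f + r *\<^sub>R g" "(r + s) *\<^sub>R f = r *\<^sub>R f + s *\<^sub>R f"
    "r *\<^sub>R s *\<^sub>R f = (r * s) *\<^sub>R f" "1 *\<^sub>R f = f" "complex_of_real r *\<^sub>C f = r *\<^sub>R f"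
    by (simp_all add: scaleR_ptensor_def C)
  show "norm f = 0 \<longleftrightarrow> f = 0"
  proof transfer
    fix X :: "nat \<Rightarrow> ('a, 'b) free_tensor" assume "ptensor_rel X X"
    then have "(\<lambda>n. proj_norm (X n)) \<longlonglongrightarrow> lim (\<lambda>n. proj_norm (X n))"
      by (simp add: ptensor_rel_def proj_Cauchy_norm flip: convergent_LIMSEQ_iff)
    then show "lim (\<lambda>n. proj_norm (X n)) = 0 \<longleftrightarrow> ptensor_rel X (\<lambda>n. 0)"
      using \<open>ptensor_rel X X\<close> by (auto simp: ptensor_rel_def proj_Cauchy_const dest: limI)
  qed
  show "norm (f + g) \<le> norm f + norm g"
  proof transfer
    fix X Y :: "nat \<Rightarrow> ('a, 'b) free_tensor" assume "ptensor_rel X X" "ptensor_rel Y Y"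
    then have *: "(\<lambda>n. proj_norm (X n)) \<longlonglongrightarrow> lim (\<lambda>n. proj_norm (X n))"
      "(\<lambda>n. proj_norm (Y n)) \<longlonglongrightarrow> lim (\<lambda>n. proj_norm (Y n))"
      "(\<lambda>n. proj_norm (X n + Y n)) \<longlonglongrightarrow> lim (\<lambda>n. proj_norm (X n + Y n))"
      by (simp_all add: ptensor_rel_def proj_Cauchy_norm proj_Cauchy_add flip: convergent_LIMSEQ_iff)
    show "lim (\<lambda>n. proj_norm (X n + Y n)) \<le> lim (\<lambda>n. proj_norm (X n)) + lim (\<lambda>n. proj_norm (Y n))"
      by (rule tendsto_le[OF _ tendsto_add[OF *(1,2)] *(3)]) (auto simp: proj_norm_add)
  qed
  show nC: "norm (c *\<^sub>C f) = cmod c * norm f" for c and f :: "('a, 'b) ptensor"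
  proof transfer
    fix c and X :: "nat \<Rightarrow> ('a, 'b) free_tensor" assume "ptensor_rel X X"
    then have "(\<lambda>n. cmod c * proj_norm (X n)) \<longlonglongrightarrow> cmod c * lim (\<lambda>n. proj_norm (X n))"
      by (intro tendsto_intros) (simp add: ptensor_rel_def proj_Cauchy_norm flip: convergent_LIMSEQ_iff)
    then show "lim (\<lambda>n. proj_norm (free_scale c (X n))) = cmod c * lim (\<lambda>n. proj_norm (X n))"
      by (simp add: proj_norm_scale limI)
  qed
  show "norm (r *\<^sub>R f) = \<bar>r\<bar> * norm f"
    by (simp add: scaleR_ptensor_def nC)
qed (fact dist_ptensor_def sgn_ptensor_def uniformity_ptensor_def open_ptensor_def)+

end

definition free_to_ptensor ::
  "('b::complex_normed_vector, 'c::complex_normed_vector) free_tensor \<Rightarrow> ('b, 'c) ptensor"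
  where "free_to_ptensor u = abs_ptensor (\<lambda>n. u)"

definition tensor :: "'b::complex_normed_vector \<Rightarrow> 'c::complex_normed_vector \<Rightarrow> ('b, 'c) ptensor"
  (infixl \<open>\<otimes>\<close> 70)
  where "x \<otimes> y = free_to_ptensor (Poly_Mapping.single (x, y) 1)"

lemma abs_ptensor_add:
  "proj_Cauchy X \<Longrightarrow> proj_Cauchy Y \<Longrightarrow> abs_ptensor X + abs_ptensor Y = abs_ptensor (\<lambda>n. X n + Y n)"
  by (simp add: plus_ptensor.abs_eq ptensor_rel_def)

lemma abs_ptensor_scale: "proj_Cauchy X \<Longrightarrow> c *\<^sub>C abs_ptensor X = abs_ptensor (\<lambda>n. free_scale c (X n))"
  by (simp add: scaleC_ptensor.abs_eq ptensor_rel_def)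

lemma abs_ptensor_norm: "proj_Cauchy X \<Longrightarrow> norm (abs_ptensor X) = lim (\<lambda>n. proj_norm (X n))"
  by (simp add: norm_ptensor.abs_eq ptensor_rel_def)

lemmas abs_ptensor_ops = abs_ptensor_add abs_ptensor_scale abs_ptensor_norm

lemma norm_free_to_ptensor: "norm (free_to_ptensor u) = proj_norm u"
  by (simp add: free_to_ptensor_def abs_ptensor_ops proj_Cauchy_const)

lemma free_to_ptensor_add: "free_to_ptensor (u + v) = free_to_ptensor u + free_to_ptensor v"
  by (simp add: free_to_ptensor_def abs_ptensor_ops proj_Cauchy_const)

lemma free_to_ptensor_scale: "free_to_ptensor (free_scale c u) = c *\<^sub>C free_to_ptensor u"
  by (simp add: free_to_ptensor_def abs_ptensor_ops proj_Cauchy_const)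

lemma free_to_ptensor_uminus: "free_to_ptensor (- u) = - free_to_ptensor u"
  using free_to_ptensor_scale[of "- 1" u]
  by (simp add: free_scale_simps uminus_ptensor_def)

lemma free_to_ptensor_diff: "free_to_ptensor (u - v) = free_to_ptensor u - free_to_ptensor v"
  using free_to_ptensor_add[of u "- v"] by (simp add: free_to_ptensor_uminus)

lemma free_to_ptensor_sum: "free_to_ptensor (\<Sum>k\<in>S. f k) = (\<Sum>k\<in>S. free_to_ptensor (f k))"
proof -
  have "free_to_ptensor 0 = (0 :: ('a, 'b) ptensor)"
    using free_to_ptensor_add[of "0 :: ('a, 'b) free_tensor" 0] by simp
  then show ?thesis
    by (induction S rule: infinite_finite_induct) (auto simp: free_to_ptensor_add)
qed

lemma free_tensor_decomp:
  "u = (\<Sum>k\<in>Poly_Mapping.keys u. free_scale (Poly_Mapping.lookup u k) (Poly_Mapping.single k 1))"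
proof (rule poly_mapping_eqI)
  fix j
  have "Poly_Mapping.lookup (\<Sum>k\<in>Poly_Mapping.keys u. free_scale (Poly_Mapping.lookup u k) (Poly_Mapping.single k 1)) j
    = (\<Sum>k\<in>Poly_Mapping.keys u. if k = j then Poly_Mapping.lookup u k else 0)"
    unfolding lookup_sum lookup_free_scale by (intro sum.cong) (auto simp: lookup_single when_def)
  then show "Poly_Mapping.lookup u j = Poly_Mapping.lookup (\<Sum>k\<in>Poly_Mapping.keys u.
      free_scale (Poly_Mapping.lookup u k) (Poly_Mapping.single k 1)) j"
    by (simp add: sum.delta in_keys_iff)
qed

lemma free_to_ptensor_expand:
  "free_to_ptensor u = (\<Sum>k\<in>Poly_Mapping.keys u. Poly_Mapping.lookup u k *\<^sub>C (fst k \<otimes> snd k))"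
  by (subst free_tensor_decomp)
    (simp only: free_to_ptensor_sum free_to_ptensor_scale tensor_def prod.collapse)

lemma ptensor_abs_limit:
  assumes "proj_Cauchy X" shows "(\<lambda>n. free_to_ptensor (X n)) \<longlonglongrightarrow> abs_ptensor X"
proof (rule LIMSEQ_I)
  fix e :: real assume "0 < e"
  obtain N where N: "\<forall>m\<ge>N. \<forall>n\<ge>N. proj_norm (X m - X n) < e / 2"
    using assms \<open>0 < e\<close> unfolding proj_Cauchy_def by (meson half_gt_zero)
  have "norm (free_to_ptensor (X n) - abs_ptensor X) < e" if "n \<ge> N" for n
  proof -
    have C: "proj_Cauchy (\<lambda>m. X n - X m)" by (intro proj_Cauchy_minus proj_Cauchy_const assms)
    have "free_to_ptensor (X n) - abs_ptensor X = abs_ptensor (\<lambda>m. X n) + (- 1) *\<^sub>C abs_ptensor X"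
      by (simp add: minus_ptensor_def uminus_ptensor_def free_to_ptensor_def)
    also have "\<dots> = abs_ptensor (\<lambda>m. X n + free_scale (- 1) (X m))"
      using assms proj_Cauchy_scale[OF assms, of "- 1"] by (simp only: abs_ptensor_ops proj_Cauchy_const)
    also have "\<dots> = abs_ptensor (\<lambda>m. X n - X m)"
      by (simp add: free_scale_simps)
    finally have "norm (free_to_ptensor (X n) - abs_ptensor X) = lim (\<lambda>m. proj_norm (X n - X m))"
      using C by (simp only: abs_ptensor_ops)
    also have "\<dots> \<le> e / 2"
    proof (rule LIMSEQ_le_const2)
      show "(\<lambda>m. proj_norm (X n - X m)) \<longlonglongrightarrow> lim (\<lambda>m. proj_norm (X n - X m))"
        using proj_Cauchy_norm[OF C] by (simp add: convergent_LIMSEQ_iff)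
      show "\<exists>N. \<forall>m\<ge>N. proj_norm (X n - X m) \<le> e / 2"
        using N that less_imp_le by blast
    qed
    finally show ?thesis using \<open>0 < e\<close> by simp
  qed
  then show "\<exists>N. \<forall>n\<ge>N. norm (free_to_ptensor (X n) - abs_ptensor X) < e" by blast
qed

lemma ptensor_limit:
  obtains X where "(\<lambda>n. free_to_ptensor (X n)) \<longlonglongrightarrow> T"
proof (induction T rule: ptensor.abs_induct)
  case (1 X)
  then show ?case using ptensor_abs_limit[of X] by (auto simp: ptensor_rel_def)
qed

instance ptensor :: (complex_normed_vector, complex_normed_vector) banach
proof
  fix T :: "nat \<Rightarrow> ('a, 'b) ptensor" assume T: "Cauchy T"
  have "\<exists>u. norm (free_to_ptensor u - T n) < inverse (Suc n)" for n
  proof -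
    obtain X where "(\<lambda>k. free_to_ptensor (X k)) \<longlonglongrightarrow> T n" by (rule ptensor_limit)
    then show ?thesis using LIMSEQ_D[of _ "T n" "inverse (Suc n)"] by fastforce
  qed
  then obtain u where u: "\<And>n. norm (free_to_ptensor (u n) - T n) < inverse (Suc n)" by metis
  have diff: "(\<lambda>n. free_to_ptensor (u n) - T n) \<longlonglongrightarrow> 0"
    by (rule Lim_null_comparison[OF _ LIMSEQ_inverse_real_of_nat]) (intro always_eventually allI less_imp_le u)
  have "Cauchy (\<lambda>n. (free_to_ptensor (u n) - T n) + T n)"
  proof -
    have "Cauchy (\<lambda>n. X n + T n)" if "Cauchy X" for X
    proof (rule CauchyI)
      fix e :: real assume "0 < e"
      obtain M where M: "\<forall>m\<ge>M. \<forall>n\<ge>M. norm (X m - X n) < e / 2"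
        using CauchyD[OF \<open>Cauchy X\<close>, of "e / 2"] \<open>0 < e\<close> by auto
      obtain N where N: "\<forall>m\<ge>N. \<forall>n\<ge>N. norm (T m - T n) < e / 2"
        using CauchyD[OF T, of "e / 2"] \<open>0 < e\<close> by auto
      have "norm (X m + T m - (X n + T n)) < e" if "m \<ge> max M N" "n \<ge> max M N" for m n
        using M[rule_format, of m n] N[rule_format, of m n] that
          norm_triangle_ineq[of "X m - X n" "T m - T n"] by (simp add: algebra_simps)
      then show "\<exists>M. \<forall>m\<ge>M. \<forall>n\<ge>M. norm (X m + T m - (X n + T n)) < e" by blast
    qed
    then show ?thesis using diff LIMSEQ_imp_Cauchy by blast
  qed
  then have "proj_Cauchy u"
    by (simp add: proj_Cauchy_def Cauchy_iff norm_free_to_ptensor flip: free_to_ptensor_diff)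
  from tendsto_diff[OF ptensor_abs_limit[OF this] diff] show "convergent T"
    by (auto simp: convergent_def)
qed

lemma bounded_cbilinear_tensor: "bounded_cbilinear (\<otimes>)"
proof -
  have eq: "free_to_ptensor u = free_to_ptensor v" if "u - v \<in> tensor_relations" for u v :: "('a, 'b) free_tensor"
    using proj_norm_relation[OF that] by (simp flip: norm_free_to_ptensor add: free_to_ptensor_diff)
  have single: "Poly_Mapping.single k c = free_scale c (Poly_Mapping.single k 1)" for k :: "'a \<times> 'b" and c
    by (rule poly_mapping_eqI) (simp add: lookup_single when_def)
  have add: "(x + x') \<otimes> y = x \<otimes> y + x' \<otimes> y" "x \<otimes> (y + y') = x \<otimes> y + x \<otimes> y'"
    for x x' :: 'a and y y' :: 'b
    using tensor_relations.add_left[of x x' y] tensor_relations.add_right[of x y y']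
    by (auto simp: tensor_def diff_diff_eq simp flip: free_to_ptensor_add intro!: eq)
  have scale: "(c *\<^sub>C x) \<otimes> y = c *\<^sub>C (x \<otimes> y)" "x \<otimes> (c *\<^sub>C y) = c *\<^sub>C (x \<otimes> y)"
    for c and x :: 'a and y :: 'b
    using tensor_relations.scale_left[of c x y] tensor_relations.scale_right[of x c y]
    by (auto simp: tensor_def simp flip: free_to_ptensor_scale single intro!: eq)
  have norm: "norm (x \<otimes> y) \<le> norm x * norm y" for x :: 'a and y :: 'b
    using proj_norm_le[of "Poly_Mapping.single (x, y) 1" "Poly_Mapping.single (x, y) 1"]
    by (simp add: tensor_def norm_free_to_ptensor tensor_relations.zero free_cost_def)
  show ?thesis
    unfolding bounded_cbilinear_def
  proof (intro conjI allI scale bounded_bilinear.intro add)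
    show "(r *\<^sub>R x) \<otimes> y = r *\<^sub>R (x \<otimes> y)" "x \<otimes> (r *\<^sub>R y) = r *\<^sub>R (x \<otimes> y)" for r and x :: 'a and y :: 'b
      by (simp_all flip: scaleC_of_real add: scale)
    show "\<exists>K. \<forall>x y. norm ((x :: 'a) \<otimes> (y :: 'b)) \<le> norm x * norm y * K"
      by (intro exI[of _ 1]) (simp add: norm)
  qed
qed

lemma bounded_clinear_ptensor_eqI:
  assumes f: "bounded_clinear f" and g: "bounded_clinear g" and eq: "\<And>x y. f (x \<otimes> y) = g (x \<otimes> y)"
  shows "f = g"
proof
  fix T :: "('a, 'b) ptensor"
  obtain X where X: "(\<lambda>n. free_to_ptensor (X n)) \<longlonglongrightarrow> T" by (rule ptensor_limit)
  have lin: "bounded_linear f" "bounded_linear g" using f g by (auto simp: bounded_clinear_def)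
  have "f (free_to_ptensor u) = g (free_to_ptensor u)" for u
    using f g lin by (simp add: free_to_ptensor_expand linear_sum bounded_linear.linear eq bounded_clinear_def)
  then have "(\<lambda>n. f (free_to_ptensor (X n))) \<longlonglongrightarrow> g T"
    using bounded_linear.tendsto[OF lin(2) X] by simp
  then show "f T = g T"
    using bounded_linear.tendsto[OF lin(1) X] LIMSEQ_unique by blast
qed

text \<open>The bounded linear extension of a bounded bilinear map; see \<open>ptensor_universal\<close>.\<close>

definition ptensor_lift ::
    "('b::complex_normed_vector \<Rightarrow> 'c::complex_normed_vector \<Rightarrow> 'e::complex_normed_vector) \<Rightarrow>
     ('b, 'c) ptensor \<Rightarrow> 'e" where
  "ptensor_lift \<beta> = (THE g. bounded_clinear g \<and> (\<forall>x y. g (x \<otimes> y) = \<beta> x y))"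

lemma ptensor_universal:
  fixes \<beta> :: "'b::complex_normed_vector \<Rightarrow> 'c::complex_normed_vector \<Rightarrow> 'e::{complex_normed_vector, banach}"
  assumes \<beta>: "bounded_cbilinear \<beta>"
  shows "\<exists>!g. bounded_clinear g \<and> (\<forall>x y. g (x \<otimes> y) = \<beta> x y)"
proof -
  interpret bounded_bilinear \<beta> using \<beta> by (simp add: bounded_cbilinear_def)
  have sc: "\<beta> (c *\<^sub>C x) y = c *\<^sub>C \<beta> x y" "\<beta> x (c *\<^sub>C y) = c *\<^sub>C \<beta> x y" for c x y
    using \<beta> by (auto simp: bounded_cbilinear_def)
  obtain K where K: "0 < K" "\<And>x y. norm (\<beta> x y) \<le> norm x * norm y * K" using pos_bounded by blast
  define L where "L u = (\<Sum>k\<in>Poly_Mapping.keys u. Poly_Mapping.lookup u k *\<^sub>C \<beta> (fst k) (snd k))" for u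
  have L_sup: "L u = (\<Sum>k\<in>S. Poly_Mapping.lookup u k *\<^sub>C \<beta> (fst k) (snd k))"
    if "finite S" "Poly_Mapping.keys u \<subseteq> S" for u S
    unfolding L_def using that by (intro sum.mono_neutral_left) (auto simp: in_keys_iff)
  have L_add: "L (u + v) = L u + L v" for u v
  proof -
    let ?S = "Poly_Mapping.keys u \<union> Poly_Mapping.keys v"
    have "L (u + v) = (\<Sum>k\<in>?S. Poly_Mapping.lookup (u + v) k *\<^sub>C \<beta> (fst k) (snd k))"
      by (rule L_sup) (use keys_add[of u v] in auto)
    also have "\<dots> = L u + L v"
      by (simp add: L_sup[of ?S] lookup_add scaleC_add_left sum.distrib)
    finally show ?thesis .
  qed
  have L_scale: "L (free_scale c u) = c *\<^sub>C L u" for c u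
  proof -
    have "L (free_scale c u) = (\<Sum>k\<in>Poly_Mapping.keys u. Poly_Mapping.lookup (free_scale c u) k *\<^sub>C \<beta> (fst k) (snd k))"
      by (rule L_sup) (use keys_free_scale[of c u] in auto)
    then show ?thesis by (simp add: L_def scaleC_sum_right scaleC_scaleC)
  qed
  have L_diff: "L (u - v) = L u - L v" for u v
    using L_add[of "u - v" v] by simp
  have L_single: "L (Poly_Mapping.single (x, y) c) = c *\<^sub>C \<beta> x y" for x y c
    by (simp add: L_def)
  have L_rel: "L u = 0" if "u \<in> tensor_relations" for u
    using that by induction (auto simp: L_add L_scale L_diff L_single add_left add_right sc, simp add: L_def)
  have L_cost: "norm (L u) \<le> K * free_cost u" for u
    unfolding L_def free_cost_def sum_distrib_left
  proof (rule sum_norm_le)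
    fix k
    show "norm (Poly_Mapping.lookup u k *\<^sub>C \<beta> (fst k) (snd k))
      \<le> K * (cmod (Poly_Mapping.lookup u k) * (norm (fst k) * norm (snd k)))"
      using mult_left_mono[OF K(2)[of "fst k" "snd k"], of "cmod (Poly_Mapping.lookup u k)"]
      by (simp add: norm_scaleC mult_ac)
  qed
  have L_norm: "norm (L u) \<le> K * proj_norm u" for u
  proof (rule field_le_epsilon)
    fix e :: real assume "0 < e"
    then obtain v where v: "u - v \<in> tensor_relations" "free_cost v < proj_norm u + e / K"
      using proj_norm_approx[of "e / K" u] K(1) by auto
    have "norm (L u) = norm (L v)" using L_rel[OF v(1)] L_diff[of u v] by simp
    also have "\<dots> \<le> K * (proj_norm u + e / K)"
      using L_cost[of v] v(2) K(1) by (meson less_imp_le mult_left_mono order_trans)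
    finally show "norm (L u) \<le> K * proj_norm u + e" using K(1) by (simp add: distrib_left)
  qed
  define G where "G T = lim (\<lambda>n. L (rep_ptensor T n))" for T
  have rep_lim: "(\<lambda>n. free_to_ptensor (rep_ptensor T n)) \<longlonglongrightarrow> T" for T :: "('b, 'c) ptensor"
  proof -
    have "proj_Cauchy (rep_ptensor T)" "abs_ptensor (rep_ptensor T) = T"
      using Quotient_rep_reflp[OF Quotient_ptensor, of T] Quotient_abs_rep[OF Quotient_ptensor, of T]
      by (auto simp: ptensor_rel_def)
    then show ?thesis using ptensor_abs_limit by metis
  qed
  have conv: "(\<lambda>n. L (X n)) \<longlonglongrightarrow> G T" if X: "(\<lambda>n. free_to_ptensor (X n)) \<longlonglongrightarrow> T" for X T
  proof -
    have small: "(\<lambda>n. L (X n) - L (Y n)) \<longlonglongrightarrow> 0" if Y: "(\<lambda>n. free_to_ptensor (Y n)) \<longlonglongrightarrow> T" for Y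
    proof (rule Lim_null_comparison)
      show "\<forall>\<^sub>F n in sequentially. norm (L (X n) - L (Y n)) \<le> K * norm (free_to_ptensor (X n) - free_to_ptensor (Y n))"
        by (simp add: L_norm norm_free_to_ptensor flip: L_diff free_to_ptensor_diff)
      show "(\<lambda>n. K * norm (free_to_ptensor (X n) - free_to_ptensor (Y n))) \<longlonglongrightarrow> 0"
        using tendsto_mult_right_zero[OF tendsto_norm_zero[OF tendsto_diff[OF X Y, simplified]]] by simp
    qed
    have "Cauchy (\<lambda>n. L (rep_ptensor T n))"
    proof (rule CauchyI)
      fix e :: real assume "0 < e"
      then have "0 < e / K" using K(1) by simp
      from CauchyD[OF LIMSEQ_imp_Cauchy[OF rep_lim] this, of T]
      obtain M where M: "\<forall>m\<ge>M. \<forall>n\<ge>M. proj_norm (rep_ptensor T m - rep_ptensor T n) < e / K"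
        by (auto simp flip: free_to_ptensor_diff simp: norm_free_to_ptensor)
      have "norm (L (rep_ptensor T m) - L (rep_ptensor T n)) < e" if "m \<ge> M" "n \<ge> M" for m n
      proof -
        have "norm (L (rep_ptensor T m) - L (rep_ptensor T n)) \<le> K * proj_norm (rep_ptensor T m - rep_ptensor T n)"
          using L_norm by (simp flip: L_diff)
        also have "\<dots> < e" using M that K(1) by (simp add: field_simps)
        finally show ?thesis .
      qed
      then show "\<exists>M. \<forall>m\<ge>M. \<forall>n\<ge>M. norm (L (rep_ptensor T m) - L (rep_ptensor T n)) < e" by blast
    qed
    then have "(\<lambda>n. L (rep_ptensor T n)) \<longlonglongrightarrow> G T"
      by (simp add: G_def Cauchy_convergent_iff convergent_LIMSEQ_iff)
    from tendsto_add[OF small[OF rep_lim] this] show ?thesis by simp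
  qed
  have G_free: "G (free_to_ptensor u) = L u" for u
    using conv[of "\<lambda>n. u" "free_to_ptensor u"] by (simp add: LIMSEQ_const_iff)
  have G_add: "G (S + T) = G S + G T" for S T
  proof (rule LIMSEQ_unique)
    show "(\<lambda>n. L (rep_ptensor S n + rep_ptensor T n)) \<longlonglongrightarrow> G (S + T)"
      by (intro conv) (simp add: free_to_ptensor_add tendsto_add rep_lim)
    show "(\<lambda>n. L (rep_ptensor S n + rep_ptensor T n)) \<longlonglongrightarrow> G S + G T"
      by (simp add: L_add tendsto_add conv rep_lim)
  qed
  have tC: "(\<lambda>n. c *\<^sub>C f n) \<longlonglongrightarrow> c *\<^sub>C l" if "f \<longlonglongrightarrow> l"
    for c l and f :: "nat \<Rightarrow> 'z::complex_normed_vector"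
    using bounded_linear.tendsto[OF _ that] bounded_clinear_scaleC[of c] by (auto simp: bounded_clinear_def)
  have G_scale: "G (c *\<^sub>C T) = c *\<^sub>C G T" for c T
  proof (rule LIMSEQ_unique)
    show "(\<lambda>n. L (free_scale c (rep_ptensor T n))) \<longlonglongrightarrow> G (c *\<^sub>C T)"
      by (intro conv) (simp add: free_to_ptensor_scale tC rep_lim)
    show "(\<lambda>n. L (free_scale c (rep_ptensor T n))) \<longlonglongrightarrow> c *\<^sub>C G T"
      by (simp add: L_scale tC conv rep_lim)
  qed
  have "bounded_linear G"
  proof (rule bounded_linear_intro[where K=K])
    show "G (r *\<^sub>R T) = r *\<^sub>R G T" for r T by (simp flip: scaleC_of_real add: G_scale)
    show "norm (G T) \<le> norm T * K" for T
    proof (rule LIMSEQ_le)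
      show "(\<lambda>n. norm (L (rep_ptensor T n))) \<longlonglongrightarrow> norm (G T)" by (intro tendsto_norm conv rep_lim)
      show "(\<lambda>n. norm (free_to_ptensor (rep_ptensor T n)) * K) \<longlonglongrightarrow> norm T * K"
        by (intro tendsto_intros rep_lim)
      show "\<exists>N. \<forall>n\<ge>N. norm (L (rep_ptensor T n)) \<le> norm (free_to_ptensor (rep_ptensor T n)) * K"
        using L_norm by (auto simp: norm_free_to_ptensor mult.commute)
    qed
  qed (fact G_add)
  then have "bounded_clinear G" by (simp add: bounded_clinear_def G_scale)
  moreover have "G (x \<otimes> y) = \<beta> x y" for x y
    by (simp add: tensor_def G_free L_single)
  ultimately show ?thesis
    by (intro ex1I[of _ G]) (auto intro: bounded_clinear_ptensor_eqI)
qed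

lemma ptensor_lift:
  fixes \<beta> :: "'b::complex_normed_vector \<Rightarrow> 'c::complex_normed_vector \<Rightarrow> 'e::{complex_normed_vector, banach}"
  assumes "bounded_cbilinear \<beta>"
  shows "bounded_clinear (ptensor_lift \<beta>)" "ptensor_lift \<beta> (x \<otimes> y) = \<beta> x y"
  using theI'[OF ptensor_universal[OF assms]] by (simp_all add: ptensor_lift_def)

section \<open>Triangular matrices\<close>

datatype 'a tri = Tri (tri_11: 'a) (tri_12: 'a) (tri_22: 'a)

instantiation tri :: (complex_normed_algebra) complex_normed_algebra
begin

definition zero_tri :: "'a tri" where "zero_tri = Tri 0 0 0"
definition plus_tri :: "'a tri \<Rightarrow> 'a tri \<Rightarrow> 'a tri"
  where "plus_tri s t = Tri (tri_11 s + tri_11 t) (tri_12 s + tri_12 t) (tri_22 s + tri_22 t)"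
definition minus_tri :: "'a tri \<Rightarrow> 'a tri \<Rightarrow> 'a tri"
  where "minus_tri s t = Tri (tri_11 s - tri_11 t) (tri_12 s - tri_12 t) (tri_22 s - tri_22 t)"
definition uminus_tri :: "'a tri \<Rightarrow> 'a tri"
  where "uminus_tri t = Tri (- tri_11 t) (- tri_12 t) (- tri_22 t)"
definition times_tri :: "'a tri \<Rightarrow> 'a tri \<Rightarrow> 'a tri"
  where "times_tri s t =
    Tri (tri_11 s * tri_11 t) (tri_11 s * tri_12 t + tri_12 s * tri_22 t) (tri_22 s * tri_22 t)"
definition scaleR_tri :: "real \<Rightarrow> 'a tri \<Rightarrow> 'a tri"
  where "scaleR_tri r t = Tri (r *\<^sub>R tri_11 t) (r *\<^sub>R tri_12 t) (r *\<^sub>R tri_22 t)"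
definition scaleC_tri :: "complex \<Rightarrow> 'a tri \<Rightarrow> 'a tri"
  where "scaleC_tri c t = Tri (c *\<^sub>C tri_11 t) (c *\<^sub>C tri_12 t) (c *\<^sub>C tri_22 t)"
definition norm_tri :: "'a tri \<Rightarrow> real"
  where "norm_tri t = norm (tri_11 t) + norm (tri_12 t) + norm (tri_22 t)"
definition dist_tri :: "'a tri \<Rightarrow> 'a tri \<Rightarrow> real"
  where "dist_tri s t = norm (s - t)"
definition sgn_tri :: "'a tri \<Rightarrow> 'a tri"
  where "sgn_tri t = scaleR (inverse (norm t)) t"
definition uniformity_tri :: "('a tri \<times> 'a tri) filter"
  where "uniformity_tri = (INF e\<in>{0 <..}. principal {(x, y). dist x y < e})"
definition open_tri :: "'a tri set \<Rightarrow> bool"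
  where "open_tri S = (\<forall>x\<in>S. \<forall>\<^sub>F (x', y) in uniformity. x' = x \<longrightarrow> y \<in> S)"

lemmas tri_ops = zero_tri_def plus_tri_def minus_tri_def uminus_tri_def times_tri_def
  scaleR_tri_def scaleC_tri_def norm_tri_def

instance
proof
  fix s t u :: "'a tri" and r r' :: real and c d :: complex
  show "s + t + u = s + (t + u)" "s + t = t + s" "0 + s = s" "- s + s = 0" "s - t = s + - t"
    "r *\<^sub>R (s + t) = r *\<^sub>R s + r *\<^sub>R t" "(r + r') *\<^sub>R s = r *\<^sub>R s + r' *\<^sub>R s"
    "r *\<^sub>R r' *\<^sub>R s = (r * r') *\<^sub>R s" "1 *\<^sub>R s = s"
    "c *\<^sub>C (s + t) = c *\<^sub>C s + c *\<^sub>C t" "(c + d) *\<^sub>C s = c *\<^sub>C s + d *\<^sub>C s"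
    "c *\<^sub>C d *\<^sub>C s = (c * d) *\<^sub>C s" "complex_of_real r *\<^sub>C s = r *\<^sub>R s"
    "s * t * u = s * (t * u)" "(s + t) * u = s * u + t * u" "s * (t + u) = s * t + s * u"
    "(r *\<^sub>R s) * t = r *\<^sub>R (s * t)" "s * (r *\<^sub>R t) = r *\<^sub>R (s * t)"
    "(c *\<^sub>C s) * t = c *\<^sub>C (s * t)" "s * (c *\<^sub>C t) = c *\<^sub>C (s * t)"
    by (simp_all add: tri_ops algebra_simps scaleC_add_left scaleC_add_right scaleC_scaleC
        scaleC_of_real scaleC_mult_left scaleC_mult_right)
  show "norm s = 0 \<longleftrightarrow> s = 0"
    by (cases s) (auto simp: tri_ops add_nonneg_eq_0_iff)
  show "norm (s + t) \<le> norm s + norm t"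
    using norm_triangle_ineq[of "tri_11 s" "tri_11 t"] norm_triangle_ineq[of "tri_12 s" "tri_12 t"]
      norm_triangle_ineq[of "tri_22 s" "tri_22 t"] by (simp add: tri_ops)
  show "norm (r *\<^sub>R s) = \<bar>r\<bar> * norm s" "norm (c *\<^sub>C s) = cmod c * norm s"
    by (simp_all add: tri_ops norm_scaleC algebra_simps)
  show "norm (s * t) \<le> norm s * norm t"
  proof -
    have "norm (s * t) \<le> norm (tri_11 s) * norm (tri_11 t)
        + (norm (tri_11 s) * norm (tri_12 t) + norm (tri_12 s) * norm (tri_22 t))
        + norm (tri_22 s) * norm (tri_22 t)"
      unfolding tri_ops tri.sel by (intro add_mono norm_triangle_le norm_mult_ineq)
    also have "\<dots> \<le> norm s * norm t"
      by (simp add: tri_ops algebra_simps)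
    finally show ?thesis .
  qed
qed (fact dist_tri_def sgn_tri_def uniformity_tri_def open_tri_def)+

end

instance tri :: ("{complex_normed_algebra, banach}") banach
proof
  fix X :: "nat \<Rightarrow> 'a tri" assume "Cauchy X"
  have le: "norm (tri_11 t) \<le> norm t" "norm (tri_12 t) \<le> norm t" "norm (tri_22 t) \<le> norm t" for t :: "'a tri"
    by (simp_all add: norm_tri_def)
  have comp: "Cauchy (\<lambda>n. p (X n))" if "\<And>s t. norm (p s - p t) \<le> norm (s - t)" for p :: "'a tri \<Rightarrow> 'a"
    using \<open>Cauchy X\<close> that unfolding Cauchy_iff by (meson order_le_less_trans)
  have "Cauchy (\<lambda>n. tri_11 (X n))" "Cauchy (\<lambda>n. tri_12 (X n))" "Cauchy (\<lambda>n. tri_22 (X n))"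
    using le[of "_ - _"] by (auto intro!: comp simp: minus_tri_def)
  then obtain a x b where *: "(\<lambda>n. tri_11 (X n)) \<longlonglongrightarrow> a" "(\<lambda>n. tri_12 (X n)) \<longlonglongrightarrow> x" "(\<lambda>n. tri_22 (X n)) \<longlonglongrightarrow> b"
    by (auto simp: Cauchy_convergent_iff convergent_def)
  have "(\<lambda>n. norm (X n - Tri a x b)) \<longlonglongrightarrow> 0"
    unfolding norm_tri_def minus_tri_def tri.sel
    using tendsto_add[OF tendsto_add[OF *(1)[THEN LIM_zero, THEN tendsto_norm_zero]
          *(2)[THEN LIM_zero, THEN tendsto_norm_zero]] *(3)[THEN LIM_zero, THEN tendsto_norm_zero]] by simp
  then have "X \<longlonglongrightarrow> Tri a x b"
    by (rule tendsto_norm_zero_cancel[THEN LIM_zero_cancel])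
  then show "convergent X" by (auto simp: convergent_def)
qed


section \<open>Bimodules, dual modules and weak topologies\<close>

definition banach_bimodule ::
    "('b::{complex_normed_algebra, banach} \<Rightarrow> 'e \<Rightarrow> 'e) \<Rightarrow>
     ('e::{complex_normed_vector, banach} \<Rightarrow> 'b \<Rightarrow> 'e) \<Rightarrow> bool" where
  "banach_bimodule l r \<longleftrightarrow> bounded_cbilinear l \<and> bounded_cbilinear r \<and>
     (\<forall>a b x. l (a * b) x = l a (l b x)) \<and> (\<forall>a b x. r x (a * b) = r (r x a) b) \<and>
     (\<forall>a b x. l a (r x b) = r (l a x) b)"

definition dual_lact :: "('e \<Rightarrow> 'b \<Rightarrow> 'e) \<Rightarrow> 'b \<Rightarrow> 'e cdual \<Rightarrow> 'e::complex_normed_vector cdual" where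
  "dual_lact r a f = to_cdual (\<lambda>x. f (r x a))"

definition dual_ract :: "('b \<Rightarrow> 'e \<Rightarrow> 'e) \<Rightarrow> 'e cdual \<Rightarrow> 'b \<Rightarrow> 'e::complex_normed_vector cdual" where
  "dual_ract l f a = to_cdual (\<lambda>x. f (l a x))"

definition initial_topology :: "('x \<Rightarrow> complex) set \<Rightarrow> 'x topology" where
  "initial_topology \<Phi> = topology_generated_by {f -` U | f U. f \<in> \<Phi> \<and> open U}"

definition weak_topology :: "'e::complex_normed_vector topology" where
  "weak_topology = initial_topology (range cdual_apply)"

definition wkstar_topology :: "'b::complex_normed_vector cdual set \<Rightarrow> 'b topology" where
  "wkstar_topology P = initial_topology (cdual_apply ` P)"

text \<open>
  For a linear subspace \<open>S\<close>, the dual space of \<open>S\<close> consists of functions that are \<open>undefined\<close> outside \<open>S\<close>, so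
  that equality of functions is equality of functionals on \<open>S\<close>. At \<open>x = 0\<close> the quotient in
  \<open>dual_on_norm\<close> is \<open>0 / 0 = 0\<close>.
\<close>

definition dual_on :: "'e::complex_normed_vector set \<Rightarrow> ('e \<Rightarrow> complex) set" where
  "dual_on S = {F \<in> extensional S.
     (\<forall>x\<in>S. \<forall>y\<in>S. F (x + y) = F x + F y) \<and> (\<forall>c. \<forall>x\<in>S. F (c *\<^sub>C x) = c * F x) \<and>
     (\<exists>K. \<forall>x\<in>S. cmod (F x) \<le> K * norm x)}"

definition dual_on_norm :: "'e::complex_normed_vector set \<Rightarrow> ('e \<Rightarrow> complex) \<Rightarrow> real" where
  "dual_on_norm S F = (SUP x\<in>S. cmod (F x) / norm x)"

definition dual_on_lact :: "'e set \<Rightarrow> ('e \<Rightarrow> 'b \<Rightarrow> 'e) \<Rightarrow> 'b \<Rightarrow> ('e \<Rightarrow> complex) \<Rightarrow> 'e \<Rightarrow> complex" where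
  "dual_on_lact S r a F = (\<lambda>x\<in>S. F (r x a))"

definition dual_on_ract :: "'e set \<Rightarrow> ('b \<Rightarrow> 'e \<Rightarrow> 'e) \<Rightarrow> ('e \<Rightarrow> complex) \<Rightarrow> 'b \<Rightarrow> 'e \<Rightarrow> complex" where
  "dual_on_ract S l F a = (\<lambda>x\<in>S. F (l a x))"


section \<open>Dual Banach algebras\<close>

text \<open>
  A dual Banach algebra is given together with its predual \<open>P\<close>; \<open>\<A> = (\<A>\<^sub>*)\<^sup>*\<close> is read as: the canonical
  evaluation map into the dual of \<open>P\<close> is an isometric isomorphism.
\<close>

definition predual_eval :: "'b::complex_normed_vector cdual set \<Rightarrow> 'b \<Rightarrow> 'b cdual \<Rightarrow> complex" where
  "predual_eval P b = (\<lambda>f\<in>P. cdual_apply f b)"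

definition dual_banach_algebra :: "'b::{complex_normed_algebra, banach} cdual set \<Rightarrow> bool" where
  "dual_banach_algebra P \<longleftrightarrow>
     closed P \<and> csubspace P \<and> (\<forall>a. \<forall>f\<in>P. dual_lact (*) a f \<in> P \<and> dual_ract (*) f a \<in> P) \<and>
     bij_betw (predual_eval P) UNIV (dual_on P) \<and> (\<forall>b. dual_on_norm P (predual_eval P b) = norm b)"

definition wkstar_characters :: "'b::{complex_normed_algebra, banach} cdual set \<Rightarrow> ('b \<Rightarrow> complex) set" where
  "wkstar_characters P = {\<phi>. (\<forall>x y. \<phi> (x + y) = \<phi> x + \<phi> y) \<and> (\<forall>c x. \<phi> (c *\<^sub>C x) = c * \<phi> x) \<and>
     (\<forall>x y. \<phi> (x * y) = \<phi> x * \<phi> y) \<and> (\<exists>x. \<phi> x \<noteq> 0) \<and>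
     continuous_map (wkstar_topology P) euclidean \<phi>}"

definition tri_functional :: "'a::complex_normed_algebra cdual \<Rightarrow> 'a cdual \<Rightarrow> 'a cdual \<Rightarrow> 'a tri cdual" where
  "tri_functional f g h = to_cdual (\<lambda>t. f (tri_11 t) + g (tri_12 t) + h (tri_22 t))"

definition tri_predual :: "'a::complex_normed_algebra cdual set \<Rightarrow> 'a tri cdual set" where
  "tri_predual P = {tri_functional f g h | f g h. f \<in> P \<and> g \<in> P \<and> h \<in> P}"


section \<open>Nets and filters\<close>

text \<open>
  Nets are represented by proper filters, as usual in Isabelle/HOL: a net in \<open>'x\<close> over a directed set of any
  index type induces its filter of tails \<open>net_filter D le x\<close>, and every proper filter arises in this way.
\<close>

definition directed_set :: "'i set \<Rightarrow> ('i \<Rightarrow> 'i \<Rightarrow> bool) \<Rightarrow> bool" where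
  "directed_set D le \<longleftrightarrow> D \<noteq> {} \<and> (\<forall>i\<in>D. le i i) \<and>
     (\<forall>i\<in>D. \<forall>j\<in>D. \<forall>k\<in>D. le i j \<longrightarrow> le j k \<longrightarrow> le i k) \<and> (\<forall>i\<in>D. \<forall>j\<in>D. \<exists>k\<in>D. le i k \<and> le j k)"

definition net_filter :: "'i set \<Rightarrow> ('i \<Rightarrow> 'i \<Rightarrow> bool) \<Rightarrow> ('i \<Rightarrow> 'x) \<Rightarrow> 'x filter" where
  "net_filter D le x = filtermap x (INF i\<in>D. principal {j \<in> D. le i j})"

lemma eventually_net_filter:
  assumes "directed_set D le"
  shows "eventually Q (net_filter D le x) \<longleftrightarrow> (\<exists>i\<in>D. \<forall>j\<in>D. le i j \<longrightarrow> Q (x j))"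
proof -
  have "eventually (\<lambda>j. Q (x j)) (INF i\<in>D. principal {j \<in> D. le i j})
    \<longleftrightarrow> (\<exists>i\<in>D. eventually (\<lambda>j. Q (x j)) (principal {j \<in> D. le i j}))"
  proof (rule eventually_INF_base)
    show "D \<noteq> {}" using assms by (simp add: directed_set_def)
    fix i j assume ij: "i \<in> D" "j \<in> D"
    then obtain k where "k \<in> D" "le i k" "le j k" using assms unfolding directed_set_def by blast
    moreover from this have "{m \<in> D. le k m} \<subseteq> {m \<in> D. le i m} \<inter> {m \<in> D. le j m}"
      using assms ij unfolding directed_set_def by blast
    ultimately show "\<exists>k\<in>D. principal {m \<in> D. le k m} \<le> inf (principal {m \<in> D. le i m}) (principal {m \<in> D. le j m})"
      by auto
  qed
  then show ?thesis by (auto simp: net_filter_def eventually_filtermap eventually_principal)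
qed

lemma net_filter_neq_bot: "directed_set D le \<Longrightarrow> net_filter D le x \<noteq> bot"
  using eventually_net_filter[of D le "\<lambda>_. False" x] unfolding directed_set_def trivial_limit_def by blast

lemma filter_is_net_filter:
  fixes F :: "'x filter"
  assumes "F \<noteq> bot"
  obtains D :: "('x \<times> 'x set) set" and le x where "directed_set D le" "F = net_filter D le x"
proof -
  define D where "D = {(x, S). x \<in> S \<and> (\<forall>\<^sub>F y in F. y \<in> S)}"
  define le :: "'x \<times> 'x set \<Rightarrow> 'x \<times> 'x set \<Rightarrow> bool" where "le i j \<longleftrightarrow> snd j \<subseteq> snd i" for i j
  have ne: "\<exists>y. y \<in> S" if "\<forall>\<^sub>F y in F. y \<in> S" for S
    using eventually_happens[OF that] assms by blast
  have D: "directed_set D le"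
    unfolding directed_set_def
  proof (intro conjI ballI)
    have "(undefined, UNIV) \<in> D" by (simp add: D_def)
    then show "D \<noteq> {}" by blast
    fix i j assume ij: "i \<in> D" "j \<in> D"
    then have S: "\<forall>\<^sub>F y in F. y \<in> snd i \<inter> snd j" by (simp add: D_def case_prod_beta eventually_conj_iff)
    then obtain y where "y \<in> snd i \<inter> snd j" using ne by blast
    with S have "(y, snd i \<inter> snd j) \<in> D" by (simp add: D_def)
    then show "\<exists>k\<in>D. le i k \<and> le j k"
      by (rule bexI[rotated]) (simp add: le_def)
  qed (auto simp: le_def)
  have "F = net_filter D le fst"
    unfolding filter_eq_iff
  proof
    fix Q
    show "eventually Q F \<longleftrightarrow> eventually Q (net_filter D le fst)"
  proof
    assume "eventually Q F"
    then have Q: "\<forall>\<^sub>F y in F. y \<in> {y. Q y}" by simp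
    then obtain y where "y \<in> {y. Q y}" using ne by blast
    with Q have "(y, {y. Q y}) \<in> D" by (auto simp: D_def)
    then show "eventually Q (net_filter D le fst)"
      unfolding eventually_net_filter[OF D] by (intro bexI[of _ "(y, {y. Q y})"]) (auto simp: le_def D_def)
  next
    assume "eventually Q (net_filter D le fst)"
    then obtain y S where "(y, S) \<in> D" and *: "\<forall>j\<in>D. le (y, S) j \<longrightarrow> Q (fst j)"
      unfolding eventually_net_filter[OF D] by auto
    then have "\<forall>\<^sub>F z in F. z \<in> S" by (simp add: D_def)
    moreover from this have "Q z" if "z \<in> S" for z
      using *[rule_format, of "(z, S)"] that by (simp add: D_def le_def)
    ultimately show "eventually Q F" by (auto elim: eventually_mono)
  qed
  qed
  with D show ?thesis by (rule that)
qed

definition left_approximate_identity :: "'a::complex_normed_algebra filter \<Rightarrow> bool" where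
  "left_approximate_identity \<E> \<longleftrightarrow> \<E> \<noteq> bot \<and> (\<forall>a. ((\<lambda>e. e * a) \<longlongrightarrow> a) \<E>)"


section \<open>Approximate Connes-biprojectivity\<close>

definition sigma_wc ::
    "'b::{complex_normed_algebra, banach} cdual set \<Rightarrow> ('b \<Rightarrow> 'e \<Rightarrow> 'e) \<Rightarrow>
     ('e::{complex_normed_vector, banach} \<Rightarrow> 'b \<Rightarrow> 'e) \<Rightarrow> 'e set" where
  "sigma_wc P l r = {x. continuous_map (wkstar_topology P) weak_topology (\<lambda>a. l a x) \<and>
     continuous_map (wkstar_topology P) weak_topology (\<lambda>a. r x a)}"

definition ptensor_lact :: "'b::complex_normed_algebra \<Rightarrow> ('b, 'b) ptensor \<Rightarrow> ('b, 'b) ptensor" where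
  "ptensor_lact a = ptensor_lift (\<lambda>b c. (a * b) \<otimes> c)"

definition ptensor_ract :: "('b, 'b) ptensor \<Rightarrow> 'b::complex_normed_algebra \<Rightarrow> ('b, 'b) ptensor" where
  "ptensor_ract T a = ptensor_lift (\<lambda>b c. b \<otimes> (c * a)) T"

definition ptensor_mult :: "('b, 'b) ptensor \<Rightarrow> 'b::complex_normed_algebra" where
  "ptensor_mult = ptensor_lift (*)"

definition ptensor_dual_lact ::
    "'b::complex_normed_algebra \<Rightarrow> ('b, 'b) ptensor cdual \<Rightarrow> ('b, 'b) ptensor cdual" where
  "ptensor_dual_lact = dual_lact ptensor_ract"

definition ptensor_dual_ract ::
    "('b, 'b) ptensor cdual \<Rightarrow> 'b::complex_normed_algebra \<Rightarrow> ('b, 'b) ptensor cdual" where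
  "ptensor_dual_ract = dual_ract ptensor_lact"

definition sigma_wc_ptensor_dual ::
    "'b::{complex_normed_algebra, banach} cdual set \<Rightarrow> ('b, 'b) ptensor cdual set" where
  "sigma_wc_ptensor_dual P = sigma_wc P ptensor_dual_lact ptensor_dual_ract"

definition ptensor_mult_adjoint :: "'b::complex_normed_algebra cdual \<Rightarrow> ('b, 'b) ptensor cdual" where
  "ptensor_mult_adjoint f = to_cdual (\<lambda>T. f (ptensor_mult T))"

text \<open>
  The functional \<open>f \<mapsto> F (\<pi>\<^sup>* f)\<close> on the predual is identified with an element of the algebra via
  \<open>predual_eval\<close>.
\<close>

definition pi_sigma_wc ::
    "'b::complex_normed_algebra cdual set \<Rightarrow> (('b, 'b) ptensor cdual \<Rightarrow> complex) \<Rightarrow> 'b" where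
  "pi_sigma_wc P F = inv (predual_eval P) (\<lambda>f\<in>P. F (ptensor_mult_adjoint f))"

text \<open>
  Continuous bimodule morphisms into the dual of the submodule \<open>\<sigma>wc\<close> of the dual of the tensor square.
\<close>

definition connes_morphisms ::
    "'b::{complex_normed_algebra, banach} cdual set \<Rightarrow> ('b \<Rightarrow> ('b, 'b) ptensor cdual \<Rightarrow> complex) set" where
  "connes_morphisms P = (let S = sigma_wc_ptensor_dual P in
     {\<rho>. (\<forall>a. \<rho> a \<in> dual_on S) \<and>
        (\<forall>a b. \<forall>x\<in>S. \<rho> (a + b) x = \<rho> a x + \<rho> b x) \<and> (\<forall>c a. \<forall>x\<in>S. \<rho> (c *\<^sub>C a) x = c * \<rho> a x) \<and>
        (\<exists>K. \<forall>a. dual_on_norm S (\<rho> a) \<le> K * norm a) \<and>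
        (\<forall>a b. \<rho> (a * b) = dual_on_lact S ptensor_dual_ract a (\<rho> b)) \<and>
        (\<forall>a b. \<rho> (a * b) = dual_on_ract S ptensor_dual_lact (\<rho> a) b)})"

definition approx_connes_biprojective :: "'b::{complex_normed_algebra, banach} cdual set \<Rightarrow> bool" where
  "approx_connes_biprojective P \<longleftrightarrow>
     (\<exists>\<R>. \<R> \<noteq> bot \<and> (\<forall>\<^sub>F \<rho> in \<R>. \<rho> \<in> connes_morphisms P) \<and>
       (\<forall>a. ((\<lambda>\<rho>. pi_sigma_wc P (\<rho> a)) \<longlongrightarrow> a) \<R>))"


section \<open>Consistency of the definitions\<close>

lemma bounded_clinear_add:
  "bounded_clinear f \<Longrightarrow> bounded_clinear g \<Longrightarrow> bounded_clinear (\<lambda>x. f x + g x)"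
  by (auto simp: bounded_clinear_def scaleC_add_right intro: bounded_linear_add)

lemma bounded_clinear_tri: "bounded_clinear tri_11" "bounded_clinear tri_12" "bounded_clinear tri_22"
  by (auto simp: bounded_clinear_def tri_ops intro!: bounded_linear_intro[where K=1])

lemma tri_functional_apply:
  "cdual_apply (tri_functional f g h) t = f (tri_11 t) + g (tri_12 t) + h (tri_22 t)"
  unfolding tri_functional_def
  by (subst to_cdual_apply)
    (auto intro!: bounded_clinear_add bounded_clinear_compose[OF bounded_clinear_cdual_apply] bounded_clinear_tri)

lemma cdual_linear:
  "cdual_apply f (x + y) = f x + f y" "cdual_apply f (c *\<^sub>C x) = c * f x" "cdual_apply f 0 = 0"
  using bounded_clinear_cdual_apply[of f]
  by (auto simp: bounded_clinear_def scaleC_complex_def linear_simps)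

lemma cdual_ops:
  "cdual_apply (f + g) x = f x + g x" "cdual_apply (f - g) x = f x - g x"
  "cdual_apply (c *\<^sub>C f) x = c * f x" "cdual_apply 0 x = 0"
  unfolding cdual_apply_def
  by (simp_all add: plus_cdual.rep_eq minus_cdual.rep_eq scaleC_cdual.rep_eq zero_cdual.rep_eq
      blinfun.add_left blinfun.diff_left)

lemma cdual_norm: "cmod (cdual_apply f x) \<le> norm f * norm x"
  unfolding cdual_apply_def norm_cdual.rep_eq by (rule norm_blinfun)

lemma cdual_norm_le: "0 \<le> K \<Longrightarrow> (\<And>x. cmod (cdual_apply f x) \<le> K * norm x) \<Longrightarrow> norm f \<le> K"
  unfolding cdual_apply_def norm_cdual.rep_eq by (rule norm_blinfun_bound)

lemma bounded_clinear_mult: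
  "bounded_clinear (\<lambda>x. a * (x :: 'a::complex_normed_algebra))"
  "bounded_clinear (\<lambda>x. (x :: 'a::complex_normed_algebra) * a)"
  by (auto simp: bounded_clinear_def scaleC_mult_left scaleC_mult_right
      bounded_linear_mult_right bounded_linear_mult_left)

lemma dual_act_apply:
  fixes f :: "'a::complex_normed_algebra cdual"
  shows "cdual_apply (dual_lact (*) a f) x = f (x * a)" "cdual_apply (dual_ract (*) f a) x = f (a * x)"
  unfolding dual_lact_def dual_ract_def
  by (simp_all add: to_cdual_apply bounded_clinear_compose[OF bounded_clinear_cdual_apply] bounded_clinear_mult)

definition tri_component :: "('a \<Rightarrow> 'a tri) \<Rightarrow> 'a::complex_normed_algebra tri cdual \<Rightarrow> 'a cdual" where
  "tri_component \<iota> F = to_cdual (\<lambda>a. F (\<iota> a))"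

lemma bounded_clinear_Tri:
  "bounded_clinear (\<lambda>a. Tri a 0 0)" "bounded_clinear (\<lambda>a. Tri 0 a 0)" "bounded_clinear (\<lambda>a. Tri 0 0 a)"
  by (auto simp: bounded_clinear_def tri_ops intro!: bounded_linear_intro[where K=1])

lemma tri_component_apply:
  "bounded_clinear \<iota> \<Longrightarrow> cdual_apply (tri_component \<iota> F) a = F (\<iota> a)"
  unfolding tri_component_def
  by (simp add: to_cdual_apply bounded_clinear_compose[OF bounded_clinear_cdual_apply])

lemma tri_functional_component:
  "tri_functional (tri_component (\<lambda>a. Tri a 0 0) F) (tri_component (\<lambda>a. Tri 0 a 0) F)
    (tri_component (\<lambda>a. Tri 0 0 a) F) = F"
proof (rule cdual_eqI)
  fix t :: "'a tri"
  have t: "Tri (tri_11 t) 0 0 + Tri 0 (tri_12 t) 0 + Tri 0 0 (tri_22 t) = t"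
    by (cases t) (simp add: tri_ops)
  show "cdual_apply (tri_functional (tri_component (\<lambda>a. Tri a 0 0) F) (tri_component (\<lambda>a. Tri 0 a 0) F)
    (tri_component (\<lambda>a. Tri 0 0 a) F)) t = F t"
    by (simp add: tri_functional_apply tri_component_apply bounded_clinear_Tri t flip: cdual_linear(1))
qed

lemma tri_component_functional:
  "tri_component (\<lambda>a. Tri a 0 0) (tri_functional f g h) = f"
  "tri_component (\<lambda>a. Tri 0 a 0) (tri_functional f g h) = g"
  "tri_component (\<lambda>a. Tri 0 0 a) (tri_functional f g h) = h"
  by (auto intro!: cdual_eqI simp: tri_component_apply bounded_clinear_Tri tri_functional_apply cdual_linear)

lemma tri_predual_iff:
  "F \<in> tri_predual P \<longleftrightarrow> tri_component (\<lambda>a. Tri a 0 0) F \<in> P \<and> tri_component (\<lambda>a. Tri 0 a 0) F \<in> P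
    \<and> tri_component (\<lambda>a. Tri 0 0 a) F \<in> P"
  unfolding tri_predual_def by (auto simp: tri_component_functional) (metis tri_functional_component)

lemma tri_component_tendsto:
  assumes i: "bounded_clinear \<iota>" and n: "\<And>a. norm (\<iota> a) = norm a" and F: "F \<longlonglongrightarrow> G"
  shows "(\<lambda>n. tri_component \<iota> (F n)) \<longlonglongrightarrow> tri_component \<iota> G"
proof (rule LIM_zero_cancel, rule Lim_null_comparison)
  have "norm (tri_component \<iota> (F n) - tri_component \<iota> G) \<le> norm (F n - G)" for n
    using cdual_norm[of "F n - G"]
    by (intro cdual_norm_le) (auto simp: cdual_ops tri_component_apply i n[symmetric])
  then show "\<forall>\<^sub>F n in sequentially. norm (tri_component \<iota> (F n) - tri_component \<iota> G) \<le> norm (F n - G)"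
    by simp
  show "(\<lambda>n. norm (F n - G)) \<longlonglongrightarrow> 0"
    using F by (intro tendsto_norm_zero LIM_zero)
qed

lemma norm_tri_functional_le:
  assumes "norm f \<le> 1" "norm g \<le> 1" "norm h \<le> 1"
  shows "norm (tri_functional f g h) \<le> 1"
proof (rule cdual_norm_le)
  fix t :: "'a tri"
  have le: "cmod (cdual_apply k x) \<le> norm x" if "norm k \<le> 1" for k :: "'a cdual" and x
    using cdual_norm[of k x] mult_right_mono[OF that norm_ge_zero[of x]] by simp
  show "cmod (cdual_apply (tri_functional f g h) t) \<le> 1 * norm t"
    unfolding tri_functional_apply norm_tri_def mult_1
    by (intro norm_triangle_le add_mono le assms)
qed simp

lemma dual_on_norm_eval:
  assumes "0 \<in> P"
  shows "f \<in> P \<Longrightarrow> cmod (cdual_apply f b) \<le> dual_on_norm P (predual_eval P b) * norm f"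
    and "dual_on_norm P (predual_eval P b) \<le> norm b"
proof -
  have le: "cmod (predual_eval P b f) / norm f \<le> norm b" if "f \<in> P" for f
    using that cdual_norm[of f b] by (cases "f = 0") (auto simp: predual_eval_def field_simps)
  then show "dual_on_norm P (predual_eval P b) \<le> norm b"
    unfolding dual_on_norm_def using assms by (intro cSUP_least) auto
  assume "f \<in> P"
  have "cmod (predual_eval P b f) / norm f \<le> dual_on_norm P (predual_eval P b)"
    unfolding dual_on_norm_def using le \<open>f \<in> P\<close> by (intro cSUP_upper bdd_aboveI2)
  then show "cmod (cdual_apply f b) \<le> dual_on_norm P (predual_eval P b) * norm f"
    using \<open>f \<in> P\<close> by (cases "f = 0") (auto simp: predual_eval_def field_simps cdual_ops)
qed

lemma predual_norming:
  assumes P: "dual_banach_algebra P" and "0 < e"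
  obtains f where "f \<in> P" "norm f \<le> 1" "norm b - e < Re (cdual_apply f b)"
proof -
  have S: "csubspace P" and n: "dual_on_norm P (predual_eval P b) = norm b"
    using P by (auto simp: dual_banach_algebra_def)
  have "P \<noteq> {}" using S by (auto simp: csubspace_def)
  have "\<exists>f\<in>P. norm b - e < cmod (predual_eval P b f) / norm f"
  proof (rule ccontr)
    assume "\<not> ?thesis"
    then have "dual_on_norm P (predual_eval P b) \<le> norm b - e"
      unfolding dual_on_norm_def using \<open>P \<noteq> {}\<close> by (intro cSUP_least) (auto simp: not_less)
    then show False using n \<open>0 < e\<close> by simp
  qed
  then obtain f where f: "f \<in> P" "norm b - e < cmod (cdual_apply f b) / norm f"
    by (auto simp: predual_eval_def)
  define z where "z = cdual_apply f b"
  define c where "c = (if z = 0 then 0 else cnj z / (cmod z * norm f))"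
  have "norm (c *\<^sub>C f) \<le> 1"
    by (auto simp: c_def norm_scaleC norm_mult norm_divide)
  moreover have "Re (cdual_apply (c *\<^sub>C f) b) = cmod z / norm f"
  proof (cases "z = 0")
    case False
    have "cnj z * z = (complex_of_real (cmod z))\<^sup>2" 
      by (simp add: complex_norm_square mult.commute flip: of_real_power)
    then have "c * z = complex_of_real (cmod z / norm f)"
      using False by (simp add: c_def power2_eq_square)
    then show ?thesis by (simp add: cdual_ops flip: z_def)
  qed (simp add: cdual_ops c_def)
  moreover have "c *\<^sub>C f \<in> P" using S f by (simp add: csubspace_def)
  ultimately show ?thesis using that f(2) by (simp add: z_def)
qed

lemma dual_banach_algebra_tri:
  fixes P :: "'a::{complex_normed_algebra, banach} cdual set"
  assumes P: "dual_banach_algebra P"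
  shows "dual_banach_algebra (tri_predual P)"
proof -
  have cl: "closed P" and S: "csubspace P"
    and act: "\<And>a f. f \<in> P \<Longrightarrow> dual_lact (*) a f \<in> P" "\<And>a f. f \<in> P \<Longrightarrow> dual_ract (*) f a \<in> P"
    and bij: "bij_betw (predual_eval P) UNIV (dual_on P)"
    using P by (auto simp: dual_banach_algebra_def)
  have S0: "0 \<in> P" and Sadd: "\<And>f g. f \<in> P \<Longrightarrow> g \<in> P \<Longrightarrow> f + g \<in> P"
    and Sscale: "\<And>c f. f \<in> P \<Longrightarrow> c *\<^sub>C f \<in> P"
    using S by (auto simp: csubspace_def)
  have tfI: "tri_functional f g h \<in> tri_predual P" if "f \<in> P" "g \<in> P" "h \<in> P" for f g h
    using that by (auto simp: tri_predual_def)
  have tf_zero: "tri_functional 0 0 0 = (0 :: 'a tri cdual)"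
    by (auto intro!: cdual_eqI simp: tri_functional_apply cdual_ops)
  have tf_add: "tri_functional f g h + tri_functional f' g' h' = tri_functional (f + f') (g + g') (h + h')"
    for f g h f' g' h' :: "'a cdual"
    by (auto intro!: cdual_eqI simp: tri_functional_apply cdual_ops)
  have tf_scale: "c *\<^sub>C tri_functional f g h = tri_functional (c *\<^sub>C f) (c *\<^sub>C g) (c *\<^sub>C h)"
    for c and f g h :: "'a cdual"
    by (auto intro!: cdual_eqI simp: tri_functional_apply cdual_ops algebra_simps)
  have sub: "csubspace (tri_predual P)"
    unfolding csubspace_def
  proof (intro conjI ballI allI)
    show "0 \<in> tri_predual P" using tfI[OF S0 S0 S0] by (simp add: tf_zero)
    show "F + G \<in> tri_predual P" if "F \<in> tri_predual P" "G \<in> tri_predual P" for F G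
      using that by (auto simp: tri_predual_def tf_add) (use Sadd in blast)
    show "c *\<^sub>C F \<in> tri_predual P" if "F \<in> tri_predual P" for c F
      using that by (auto simp: tri_predual_def tf_scale) (use Sscale in blast)
  qed
  have "closed (tri_predual P)"
    unfolding closed_sequential_limits
  proof (intro allI impI, elim conjE)
    fix F G assume F: "\<forall>n. F n \<in> tri_predual P" "F \<longlonglongrightarrow> G"
    have "tri_component \<iota> G \<in> P"
      if "bounded_clinear \<iota>" "\<And>a. norm (\<iota> a) = norm a" "\<And>n. tri_component \<iota> (F n) \<in> P" for \<iota>
      using closed_sequentially[OF cl that(3) tri_component_tendsto[OF that(1,2) F(2)]] .
    then show "G \<in> tri_predual P"
      using F(1) unfolding tri_predual_iff by (simp add: bounded_clinear_Tri tri_ops)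
  qed
  moreover have "dual_lact (*) t F \<in> tri_predual P \<and> dual_ract (*) F t \<in> tri_predual P"
    if F: "F \<in> tri_predual P" for t F
  proof -
    obtain f g h where fgh: "F = tri_functional f g h" "f \<in> P" "g \<in> P" "h \<in> P"
      using F by (auto simp: tri_predual_def)
    have "dual_lact (*) t F = tri_functional (dual_lact (*) (tri_11 t) f + dual_lact (*) (tri_12 t) g)
      (dual_lact (*) (tri_22 t) g) (dual_lact (*) (tri_22 t) h)"
      by (auto intro!: cdual_eqI simp: fgh dual_act_apply tri_functional_apply cdual_ops cdual_linear tri_ops)
    moreover have "dual_ract (*) F t = tri_functional (dual_ract (*) f (tri_11 t))
      (dual_ract (*) g (tri_11 t)) (dual_ract (*) g (tri_12 t) + dual_ract (*) h (tri_22 t))"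
      by (auto intro!: cdual_eqI simp: fgh dual_act_apply tri_functional_apply cdual_ops cdual_linear tri_ops)
    ultimately show ?thesis using fgh act Sadd by (simp add: tfI)
  qed
  moreover have "dual_on_norm (tri_predual P) (predual_eval (tri_predual P) t) = norm t" for t
  proof (rule antisym)
    let ?N = "dual_on_norm (tri_predual P) (predual_eval (tri_predual P) t)"
    have T0: "0 \<in> tri_predual P" using sub by (simp add: csubspace_def)
    show "?N \<le> norm t" by (rule dual_on_norm_eval(2)[OF T0])
    show "norm t \<le> ?N"
    proof (rule field_le_epsilon)
      fix e :: real assume "0 < e"
      then have e: "0 < e / 3" by simp
      obtain f where f: "f \<in> P" "norm f \<le> 1" "norm (tri_11 t) - e / 3 < Re (cdual_apply f (tri_11 t))"
        by (rule predual_norming[OF P e])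
      obtain g where g: "g \<in> P" "norm g \<le> 1" "norm (tri_12 t) - e / 3 < Re (cdual_apply g (tri_12 t))"
        by (rule predual_norming[OF P e])
      obtain h where h: "h \<in> P" "norm h \<le> 1" "norm (tri_22 t) - e / 3 < Re (cdual_apply h (tri_22 t))"
        by (rule predual_norming[OF P e])
      have "cmod (cdual_apply (tri_functional f g h) t) \<le> ?N * norm (tri_functional f g h)"
        by (rule dual_on_norm_eval(1)[OF T0 tfI]) fact+
      also have "\<dots> \<le> ?N"
      proof -
        have "0 \<le> ?N"
          unfolding dual_on_norm_def
          using cdual_norm[of _ t] T0
          by (intro cSUP_upper2[OF _ T0] bdd_aboveI2[where M="norm t"])
            (auto simp: predual_eval_def divide_le_eq mult.commute)
        then show ?thesis
          using norm_tri_functional_le[OF f(2) g(2) h(2)] by (simp add: mult_left_le)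
      qed
      finally show "norm t \<le> ?N + e"
        using complex_Re_le_cmod[of "cdual_apply (tri_functional f g h) t"] f(3) g(3) h(3)
        by (simp add: tri_functional_apply norm_tri_def)
    qed
  qed
  moreover have "bij_betw (predual_eval (tri_predual P)) UNIV (dual_on (tri_predual P))"
    unfolding bij_betw_def
  proof (intro conjI set_eqI iffI)
    show "inj (predual_eval (tri_predual P))"
    proof (rule injI)
      fix s t assume eq: "predual_eval (tri_predual P) s = predual_eval (tri_predual P) t"
      have F: "cdual_apply F s = cdual_apply F t" if "F \<in> tri_predual P" for F
        using fun_cong[OF eq, of F] that by (simp add: predual_eval_def)
      have inj: "x = y" if "\<And>f. f \<in> P \<Longrightarrow> cdual_apply f x = cdual_apply f y" for x y
        using bij that by (auto simp: bij_betw_def predual_eval_def restrict_def fun_eq_iff inj_def)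
      show "s = t"
        using F[OF tfI[OF _ S0 S0]] F[OF tfI[OF S0 _ S0]] F[OF tfI[OF S0 S0]]
        by (intro tri.expand conjI) (auto intro!: inj simp: tri_functional_apply cdual_ops)
    qed
  next
    fix G assume "G \<in> range (predual_eval (tri_predual P))"
    then obtain t where G: "G = predual_eval (tri_predual P) t" by auto
    have "F + F' \<in> tri_predual P" "c *\<^sub>C F \<in> tri_predual P" if "F \<in> tri_predual P" "F' \<in> tri_predual P" for F F' c
      using sub that by (auto simp: csubspace_def)
    then show "G \<in> dual_on (tri_predual P)"
      using cdual_norm[of _ t]
      by (auto simp: G dual_on_def predual_eval_def cdual_ops mult.commute intro!: exI[of _ "norm t"])
  next
    fix G assume G: "G \<in> dual_on (tri_predual P)"
    then have Gadd: "\<And>F F'. F \<in> tri_predual P \<Longrightarrow> F' \<in> tri_predual P \<Longrightarrow> G (F + F') = G F + G F'"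
      and Gscale: "\<And>c F. F \<in> tri_predual P \<Longrightarrow> G (c *\<^sub>C F) = c * G F"
      and Gext: "G \<in> extensional (tri_predual P)"
      by (auto simp: dual_on_def)
    obtain K where K: "\<And>F. F \<in> tri_predual P \<Longrightarrow> cmod (G F) \<le> K * norm F"
      using G unfolding dual_on_def by blast
    have rep: "\<exists>a. \<forall>f\<in>P. G (E f) = cdual_apply f a"
      if "\<And>f. f \<in> P \<Longrightarrow> E f \<in> tri_predual P" "\<And>f g. E (f + g) = E f + E g" "\<And>c f. E (c *\<^sub>C f) = c *\<^sub>C E f"
        "\<And>f. norm (E f) \<le> norm f" for E
    proof -
      have "cmod (G (E f)) \<le> \<bar>K\<bar> * norm f" if "f \<in> P" for f
      proof -
        have "cmod (G (E f)) \<le> K * norm (E f)" using K \<open>f \<in> P\<close> \<open>\<And>f. f \<in> P \<Longrightarrow> E f \<in> tri_predual P\<close> by blast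
        also have "\<dots> \<le> \<bar>K\<bar> * norm f"
          using \<open>norm (E f) \<le> norm f\<close> by (intro mult_mono) auto
        finally show ?thesis .
      qed
      then have "(\<lambda>f\<in>P. G (E f)) \<in> dual_on P"
        using that by (auto simp: dual_on_def Sadd Sscale Gadd Gscale)
      then obtain a where "(\<lambda>f\<in>P. G (E f)) = predual_eval P a"
        using bij by (auto simp: bij_betw_def)
      then have "\<forall>f\<in>P. G (E f) = cdual_apply f a"
        by (auto simp: predual_eval_def restrict_def fun_eq_iff split: if_splits)
      then show ?thesis ..
    qed
    have small: "norm (tri_functional f 0 0) \<le> norm f" "norm (tri_functional 0 f 0) \<le> norm f"
      "norm (tri_functional 0 0 f) \<le> norm f" for f :: "'a cdual"
    proof -
      have le: "cmod (cdual_apply f x) \<le> norm f * norm t" if "norm x \<le> norm t" for x and t :: "'a tri"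
        using cdual_norm[of f x] mult_left_mono[OF that norm_ge_zero[of f]] by linarith
      have n: "norm (tri_11 t) \<le> norm t" "norm (tri_12 t) \<le> norm t" "norm (tri_22 t) \<le> norm t"
        for t :: "'a tri"
        by (simp_all add: norm_tri_def)
      show "norm (tri_functional f 0 0) \<le> norm f" "norm (tri_functional 0 f 0) \<le> norm f"
        "norm (tri_functional 0 0 f) \<le> norm f"
        using le[OF n(1)] le[OF n(2)] le[OF n(3)]
        by (auto intro!: cdual_norm_le simp: tri_functional_apply cdual_ops)
    qed
    obtain a where a: "\<And>f. f \<in> P \<Longrightarrow> G (tri_functional f 0 0) = cdual_apply f a"
      using rep[of "\<lambda>f. tri_functional f 0 0"] by (auto simp: tf_add tf_scale tfI S0 small)
    obtain x where x: "\<And>f. f \<in> P \<Longrightarrow> G (tri_functional 0 f 0) = cdual_apply f x"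
      using rep[of "\<lambda>f. tri_functional 0 f 0"] by (auto simp: tf_add tf_scale tfI S0 small)
    obtain b where b: "\<And>f. f \<in> P \<Longrightarrow> G (tri_functional 0 0 f) = cdual_apply f b"
      using rep[of "\<lambda>f. tri_functional 0 0 f"] by (auto simp: tf_add tf_scale tfI S0 small)
    have "G F = predual_eval (tri_predual P) (Tri a x b) F" if F: "F \<in> tri_predual P" for F
    proof -
      obtain f g h where fgh: "F = tri_functional f g h" "f \<in> P" "g \<in> P" "h \<in> P"
        using F by (auto simp: tri_predual_def)
      then have "F = (tri_functional f 0 0 + tri_functional 0 g 0) + tri_functional 0 0 h"
        by (simp add: tf_add)
      moreover have "tri_functional f 0 0 + tri_functional 0 g 0 \<in> tri_predual P"
        using fgh by (simp add: tf_add tfI S0)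
      ultimately have "G F = G (tri_functional f 0 0) + G (tri_functional 0 g 0) + G (tri_functional 0 0 h)"
        using Gadd[OF _ tfI[OF S0 S0 fgh(4)]] Gadd[OF tfI[OF fgh(2) S0 S0] tfI[OF S0 fgh(3) S0]] by simp
      then have "G F = cdual_apply f a + cdual_apply g x + cdual_apply h b"
        using fgh by (simp add: a x b)
      then show ?thesis using F fgh by (simp add: predual_eval_def tri_functional_apply)
    qed
    then have "G = predual_eval (tri_predual P) (Tri a x b)"
      using Gext by (intro extensionalityI[of _ "tri_predual P"]) (auto simp: predual_eval_def)
    then show "G \<in> range (predual_eval (tri_predual P))" by blast
  qed
  ultimately show ?thesis using sub by (simp add: dual_banach_algebra_def)
qed


lemma ptensor_lift_norm:
  fixes \<beta> :: "'b::complex_normed_vector \<Rightarrow> 'c::complex_normed_vector \<Rightarrow> 'e::{complex_normed_vector, banach}"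
  assumes \<beta>: "bounded_cbilinear \<beta>" and K: "0 \<le> K" "\<And>x y. norm (\<beta> x y) \<le> K * (norm x * norm y)"
  shows "norm (ptensor_lift \<beta> T) \<le> K * norm T"
proof -
  define G where "G = ptensor_lift \<beta>"
  have G: "bounded_linear G" "G (c *\<^sub>C T) = c *\<^sub>C G T" "G (x \<otimes> y) = \<beta> x y" for c T x y
    using ptensor_lift[OF \<beta>] by (auto simp: G_def bounded_clinear_def)
  have cost: "norm (G (free_to_ptensor v)) \<le> K * free_cost v" for v
  proof -
    have "G (free_to_ptensor v) = (\<Sum>k\<in>Poly_Mapping.keys v. Poly_Mapping.lookup v k *\<^sub>C \<beta> (fst k) (snd k))"
      by (simp add: free_to_ptensor_expand linear_sum[OF bounded_linear.linear[OF G(1)]] G)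
    also have "norm \<dots> \<le> K * free_cost v"
      unfolding free_cost_def sum_distrib_left
    proof (rule sum_norm_le)
      fix k
      show "norm (Poly_Mapping.lookup v k *\<^sub>C \<beta> (fst k) (snd k))
        \<le> K * (cmod (Poly_Mapping.lookup v k) * (norm (fst k) * norm (snd k)))"
        using mult_left_mono[OF K(2)[of "fst k" "snd k"], of "cmod (Poly_Mapping.lookup v k)"]
        by (simp add: norm_scaleC mult_ac)
    qed
    finally show ?thesis .
  qed
  have free: "norm (G (free_to_ptensor u)) \<le> K * proj_norm u" for u
  proof (rule field_le_epsilon)
    fix e :: real assume "0 < e"
    then obtain v where v: "u - v \<in> tensor_relations" "free_cost v < proj_norm u + e / (K + 1)"
      using proj_norm_approx[of "e / (K + 1)" u] K(1) by auto
    have "free_to_ptensor u = free_to_ptensor v"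
      using proj_norm_relation[OF v(1)] by (simp flip: norm_free_to_ptensor add: free_to_ptensor_diff)
    then have "norm (G (free_to_ptensor u)) \<le> K * free_cost v" using cost by simp
    also have "\<dots> \<le> K * (proj_norm u + e / (K + 1))" using v(2) K(1) by (simp add: mult_left_mono)
    also have "\<dots> \<le> K * proj_norm u + e"
      using scale_bound[OF \<open>0 < e\<close> K(1)] by (simp add: distrib_left)
    finally show "norm (G (free_to_ptensor u)) \<le> K * proj_norm u + e" .
  qed
  obtain X where X: "(\<lambda>n. free_to_ptensor (X n)) \<longlonglongrightarrow> T" by (rule ptensor_limit)
  have "norm (G T) \<le> K * norm T"
  proof (rule LIMSEQ_le)
    show "(\<lambda>n. norm (G (free_to_ptensor (X n)))) \<longlonglongrightarrow> norm (G T)"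
      by (intro tendsto_norm bounded_linear.tendsto[OF G(1)] X)
    show "(\<lambda>n. K * norm (free_to_ptensor (X n))) \<longlonglongrightarrow> K * norm T"
      by (intro tendsto_intros X)
    show "\<exists>N. \<forall>n\<ge>N. norm (G (free_to_ptensor (X n))) \<le> K * norm (free_to_ptensor (X n))"
      using free by (auto simp: norm_free_to_ptensor)
  qed
  then show ?thesis by (simp add: G_def)
qed

lemma norm_tensor_le: "norm (x \<otimes> y) \<le> norm x * norm y"
  using proj_norm_le[of "Poly_Mapping.single (x, y) 1" "Poly_Mapping.single (x, y) 1"]
  by (simp add: tensor_def norm_free_to_ptensor tensor_relations.zero free_cost_def)

lemma bounded_cbilinearI:
  assumes "\<And>x x' y. \<beta> (x + x') y = \<beta> x y + \<beta> x' y" "\<And>x y y'. \<beta> x (y + y') = \<beta> x y + \<beta> x y'"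
    and "\<And>c x y. \<beta> (c *\<^sub>C x) y = c *\<^sub>C \<beta> x y" "\<And>c x y. \<beta> x (c *\<^sub>C y) = c *\<^sub>C \<beta> x y"
    and "\<And>x y. norm (\<beta> x y) \<le> norm x * norm y * K"
  shows "bounded_cbilinear \<beta>"
  unfolding bounded_cbilinear_def
proof (intro conjI allI bounded_bilinear.intro)
  show "\<beta> (r *\<^sub>R x) y = r *\<^sub>R \<beta> x y" "\<beta> x (r *\<^sub>R y) = r *\<^sub>R \<beta> x y" for r x y
    by (simp_all flip: scaleC_of_real add: assms)
qed (use assms in auto)

lemma bounded_cbilinear_ops:
  assumes "bounded_cbilinear \<beta>"
  shows "\<beta> (x + x') y = \<beta> x y + \<beta> x' y" "\<beta> x (y + y') = \<beta> x y + \<beta> x y'"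
    and "\<beta> (c *\<^sub>C x) y = c *\<^sub>C \<beta> x y" "\<beta> x (c *\<^sub>C y) = c *\<^sub>C \<beta> x y"
    and "bounded_clinear (\<beta> x)" "bounded_clinear (\<lambda>x. \<beta> x y)"
proof -
  interpret bounded_bilinear \<beta> using assms by (simp add: bounded_cbilinear_def)
  show "\<beta> (x + x') y = \<beta> x y + \<beta> x' y" "\<beta> x (y + y') = \<beta> x y + \<beta> x y'"
    by (rule add_left add_right)+
  show "\<beta> (c *\<^sub>C x) y = c *\<^sub>C \<beta> x y" "\<beta> x (c *\<^sub>C y) = c *\<^sub>C \<beta> x y"
    "bounded_clinear (\<beta> x)" "bounded_clinear (\<lambda>x. \<beta> x y)"
    using assms bounded_linear_left bounded_linear_right by (auto simp: bounded_cbilinear_def bounded_clinear_def)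
qed

lemma bounded_cbilinear_mult: "bounded_cbilinear ((*) :: 'b::complex_normed_algebra \<Rightarrow> 'b \<Rightarrow> 'b)"
  by (rule bounded_cbilinearI[where K=1])
    (auto simp: algebra_simps scaleC_mult_left scaleC_mult_right norm_mult_ineq)

lemma banach_bimodule_mult: "banach_bimodule (*) (*)"
  by (simp add: banach_bimodule_def bounded_cbilinear_mult mult.assoc)

lemma ptensor_mult:
  fixes x y :: "'b::{complex_normed_algebra, banach}"
  shows "bounded_clinear (ptensor_mult :: ('b, 'b) ptensor \<Rightarrow> 'b)" "ptensor_mult (x \<otimes> y) = x * y"
  unfolding ptensor_mult_def by (rule ptensor_lift[OF bounded_cbilinear_mult])+

lemma
  fixes a :: "'b::complex_normed_algebra"
  shows bounded_cbilinear_lact: "bounded_cbilinear (\<lambda>b c. (a * b) \<otimes> (c :: 'b))" (is ?L)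
    and bounded_cbilinear_ract: "bounded_cbilinear (\<lambda>b c. (b :: 'b) \<otimes> (c * a))" (is ?R)
proof -
  note t = bounded_cbilinear_ops[OF bounded_cbilinear_tensor]
  have "norm ((a * b) \<otimes> c) \<le> norm b * norm c * norm a" "norm (b \<otimes> (c * a)) \<le> norm b * norm c * norm a" for b c :: 'b
    using order_trans[OF norm_tensor_le mult_right_mono[OF norm_mult_ineq[of a b] norm_ge_zero[of c]]]
      order_trans[OF norm_tensor_le mult_left_mono[OF norm_mult_ineq[of c a] norm_ge_zero[of b]]]
    by (simp_all add: mult_ac)
  then show ?L ?R
    by (auto intro!: bounded_cbilinearI[where K="norm a"] simp: t algebra_simps scaleC_mult_left scaleC_mult_right)
qed

lemma ptensor_act_tensor:
  fixes a b c :: "'b::complex_normed_algebra"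
  shows "ptensor_lact a (b \<otimes> c) = (a * b) \<otimes> c" "ptensor_ract (b \<otimes> c) a = b \<otimes> (c * a)"
    and "bounded_clinear (ptensor_lact a)" "bounded_clinear (\<lambda>T. ptensor_ract T a)"
  unfolding ptensor_lact_def ptensor_ract_def
  using ptensor_lift[OF bounded_cbilinear_lact[of a]] ptensor_lift[OF bounded_cbilinear_ract[of a]] by auto

lemma banach_bimodule_ptensor:
  "banach_bimodule ptensor_lact (ptensor_ract :: ('b, 'b) ptensor \<Rightarrow> 'b::{complex_normed_algebra, banach} \<Rightarrow> _)"
proof -
  note t = bounded_cbilinear_ops[OF bounded_cbilinear_tensor]
  note A = ptensor_act_tensor
  have lin: "f (S + T) = f S + f T" "f (c *\<^sub>C T) = c *\<^sub>C f T" if "bounded_clinear f"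
    for f :: "('b, 'b) ptensor \<Rightarrow> ('b, 'b) ptensor" and S T c
    using that by (auto simp: bounded_clinear_def linear_simps)
  have eqI: "f T = g T" if "bounded_clinear f" "bounded_clinear g" "\<And>x y. f (x \<otimes> y) = g (x \<otimes> y)"
    for f g :: "('b, 'b) ptensor \<Rightarrow> ('b, 'b) ptensor" and T
    using bounded_clinear_ptensor_eqI[OF that] by simp
  note cl = A(3,4) bounded_clinear_add bounded_clinear_scaleC
    bounded_clinear_compose[OF A(3)] bounded_clinear_compose[OF A(4)] bounded_clinear_compose[OF bounded_clinear_scaleC]
  have nl: "norm (ptensor_lact a T) \<le> norm a * norm T" for a :: 'b and T
    unfolding ptensor_lact_def
  proof (rule ptensor_lift_norm[OF bounded_cbilinear_lact norm_ge_zero])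
    show "norm ((a * b) \<otimes> c) \<le> norm a * (norm b * norm c)" for b c
      using order_trans[OF norm_tensor_le mult_right_mono[OF norm_mult_ineq[of a b] norm_ge_zero[of c]]]
      by (simp add: mult_ac)
  qed
  have nr: "norm (ptensor_ract T a) \<le> norm a * norm T" for a :: 'b and T
    unfolding ptensor_ract_def
  proof (rule ptensor_lift_norm[OF bounded_cbilinear_ract norm_ge_zero])
    show "norm (b \<otimes> (c * a)) \<le> norm a * (norm b * norm c)" for b c
      using order_trans[OF norm_tensor_le mult_left_mono[OF norm_mult_ineq[of c a] norm_ge_zero[of b]]]
      by (simp add: mult_ac)
  qed
  have "bounded_cbilinear (ptensor_lact :: 'b \<Rightarrow> _)"
  proof (rule bounded_cbilinearI[where K=1])
    fix a a' :: 'b and T c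
    show "ptensor_lact (a + a') T = ptensor_lact a T + ptensor_lact a' T"
      by (rule eqI[of "ptensor_lact (a + a')" "\<lambda>T. ptensor_lact a T + ptensor_lact a' T"]; (intro cl)?)
        (simp add: A t distrib_right)
    show "ptensor_lact (c *\<^sub>C a) T = c *\<^sub>C ptensor_lact a T"
      by (rule eqI[of "ptensor_lact (c *\<^sub>C a)" "\<lambda>T. c *\<^sub>C ptensor_lact a T"]; (intro cl)?)
        (simp add: A t scaleC_mult_left)
  qed (use nl in \<open>simp_all add: lin A\<close>)
  moreover have "bounded_cbilinear (ptensor_ract :: _ \<Rightarrow> 'b \<Rightarrow> _)"
  proof (rule bounded_cbilinearI[where K=1])
    fix a a' :: 'b and T c
    show "ptensor_ract T (a + a') = ptensor_ract T a + ptensor_ract T a'"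
      by (rule eqI[of "\<lambda>T. ptensor_ract T (a + a')" "\<lambda>T. ptensor_ract T a + ptensor_ract T a'"]; (intro cl)?)
        (simp add: A t distrib_left)
    show "ptensor_ract T (c *\<^sub>C a) = c *\<^sub>C ptensor_ract T a"
      by (rule eqI[of "\<lambda>T. ptensor_ract T (c *\<^sub>C a)" "\<lambda>T. c *\<^sub>C ptensor_ract T a"]; (intro cl)?)
        (simp add: A t scaleC_mult_right)
  qed (use nr in \<open>simp_all add: lin A lin[OF A(4)] mult.commute\<close>)
  moreover have "ptensor_lact (a * b) T = ptensor_lact a (ptensor_lact b T)"
    "ptensor_ract T (a * b) = ptensor_ract (ptensor_ract T a) b"
    "ptensor_lact a (ptensor_ract T b) = ptensor_ract (ptensor_lact a T) b" for a b :: 'b and T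
    by (rule eqI[of "ptensor_lact (a * b)" "\<lambda>T. ptensor_lact a (ptensor_lact b T)"]
          eqI[of "\<lambda>T. ptensor_ract T (a * b)" "\<lambda>T. ptensor_ract (ptensor_ract T a) b"]
          eqI[of "\<lambda>T. ptensor_lact a (ptensor_ract T b)" "\<lambda>T. ptensor_ract (ptensor_lact a T) b"];
        (intro cl)?; simp add: A mult.assoc)+
  ultimately show ?thesis by (simp add: banach_bimodule_def)
qed

lemma dual_act:
  assumes "banach_bimodule l r"
  shows "cdual_apply (dual_lact r a f) x = f (r x a)" "cdual_apply (dual_ract l f a) x = f (l a x)"
  using assms unfolding dual_lact_def dual_ract_def banach_bimodule_def
  by (simp_all add: to_cdual_apply bounded_clinear_compose[OF bounded_clinear_cdual_apply] bounded_cbilinear_ops)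

lemma banach_bimodule_dual:
  assumes B: "banach_bimodule l r"
  shows "banach_bimodule (dual_lact r) (dual_ract l)"
proof -
  have l: "bounded_cbilinear l" and r: "bounded_cbilinear r"
    and assoc: "\<And>a b x. l (a * b) x = l a (l b x)" "\<And>a b x. r x (a * b) = r (r x a) b"
      "\<And>a b x. l a (r x b) = r (l a x) b"
    using B by (auto simp: banach_bimodule_def)
  note s = dual_act[OF B] cdual_ops cdual_linear bounded_cbilinear_ops[OF l] bounded_cbilinear_ops[OF r] assoc
  obtain K L where K: "\<And>a x. norm (l a x) \<le> norm a * norm x * K" and L: "\<And>a x. norm (r x a) \<le> norm x * norm a * L"
    and pos: "0 \<le> K" "0 \<le> L"
    using bounded_bilinear.nonneg_bounded[of l] bounded_bilinear.nonneg_bounded[of r] l r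
    unfolding bounded_cbilinear_def by metis
  have nl: "norm (dual_lact r a f) \<le> norm a * norm f * L" for a f
  proof (rule cdual_norm_le)
    show "cmod (cdual_apply (dual_lact r a f) x) \<le> norm a * norm f * L * norm x" for x
      using cdual_norm[of f "r x a"] mult_left_mono[OF L[of x a] norm_ge_zero[of f]] by (simp add: s mult_ac)
  qed (simp add: pos)
  have nr: "norm (dual_ract l f a) \<le> norm f * norm a * K" for a f
  proof (rule cdual_norm_le)
    show "cmod (cdual_apply (dual_ract l f a) x) \<le> norm f * norm a * K * norm x" for x
      using cdual_norm[of f "l a x"] mult_left_mono[OF K[of a x] norm_ge_zero[of f]] by (simp add: s mult_ac)
  qed (simp add: pos)
  have "bounded_cbilinear (dual_lact r)"
    by (rule bounded_cbilinearI[OF _ _ _ _ nl]) (auto intro!: cdual_eqI simp: s)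
  moreover have "bounded_cbilinear (dual_ract l)"
    by (rule bounded_cbilinearI[OF _ _ _ _ nr]) (auto intro!: cdual_eqI simp: s)
  ultimately show ?thesis
    unfolding banach_bimodule_def by (auto intro!: cdual_eqI simp: s)
qed

lemma ptensor_mult_adjoint_apply:
  fixes f :: "'b::{complex_normed_algebra, banach} cdual"
  shows "cdual_apply (ptensor_mult_adjoint f) T = f (ptensor_mult T)"
  unfolding ptensor_mult_adjoint_def
  by (simp add: to_cdual_apply bounded_clinear_compose[OF bounded_clinear_cdual_apply] ptensor_mult)

lemma bounded_clinear_ptensor_mult_adjoint:
  "bounded_clinear (ptensor_mult_adjoint :: 'b::{complex_normed_algebra, banach} cdual \<Rightarrow> _)"
proof -
  obtain K where K: "0 < K" "\<And>T. norm (ptensor_mult (T :: ('b, 'b) ptensor)) \<le> norm T * K"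
    using bounded_linear.pos_bounded[of "ptensor_mult :: ('b, 'b) ptensor \<Rightarrow> 'b"] ptensor_mult(1)
    by (auto simp: bounded_clinear_def)
  have n: "norm (ptensor_mult_adjoint f) \<le> norm f * K" for f :: "'b cdual"
  proof (rule cdual_norm_le)
    show "cmod (cdual_apply (ptensor_mult_adjoint f) T) \<le> norm f * K * norm T" for T
      using cdual_norm[of f "ptensor_mult T"] mult_left_mono[OF K(2)[of T] norm_ge_zero[of f]]
      by (simp add: ptensor_mult_adjoint_apply mult_ac)
  qed (use K in simp)
  have C: "ptensor_mult_adjoint (c *\<^sub>C f) = c *\<^sub>C ptensor_mult_adjoint f" for c and f :: "'b cdual"
    by (auto intro!: cdual_eqI simp: ptensor_mult_adjoint_apply cdual_ops)
  have "bounded_linear (ptensor_mult_adjoint :: 'b cdual \<Rightarrow> _)"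
  proof (rule bounded_linear_intro[OF _ _ n])
    show "ptensor_mult_adjoint (f + g) = ptensor_mult_adjoint f + ptensor_mult_adjoint g" for f g :: "'b cdual"
      by (auto intro!: cdual_eqI simp: ptensor_mult_adjoint_apply cdual_ops)
    show "ptensor_mult_adjoint (r *\<^sub>R f) = r *\<^sub>R ptensor_mult_adjoint f" for r and f :: "'b cdual"
      by (simp flip: scaleC_of_real add: C)
  qed
  then show ?thesis by (simp add: bounded_clinear_def C)
qed

lemma dual_on_restrict:
  assumes "csubspace S" "bounded_clinear F"
  shows "(\<lambda>x\<in>S. F x) \<in> dual_on S"
  using assms bounded_linear.bounded[of F]
  by (auto simp: dual_on_def csubspace_def bounded_clinear_def linear_simps scaleC_complex_def mult.commute)

lemma predual_eval_cases:
  assumes "dual_banach_algebra P" "F \<in> dual_on P"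
  obtains b where "\<And>f. f \<in> P \<Longrightarrow> F f = cdual_apply f b"
proof -
  have "F \<in> range (predual_eval P)"
    using assms by (simp add: dual_banach_algebra_def bij_betw_def)
  then obtain b where "F = predual_eval P b" by blast
  then show ?thesis by (intro that[of b]) (simp add: predual_eval_def)
qed

lemma ptensor_mult_adjoint_sigma_wc:
  fixes P :: "'b::{complex_normed_algebra, banach} cdual set"
  assumes P: "dual_banach_algebra P" and f: "f \<in> P"
  shows "ptensor_mult_adjoint f \<in> sigma_wc_ptensor_dual P"
proof -
  have sub: "csubspace P" and act: "\<And>a f. f \<in> P \<Longrightarrow> dual_lact (*) a f \<in> P \<and> dual_ract (*) f a \<in> P"
    using P by (auto simp: dual_banach_algebra_def)
  have "0 \<in> P" using sub by (simp add: csubspace_def)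
  have top: "topspace (wkstar_topology P) = UNIV"
    unfolding wkstar_topology_def initial_topology_def topology_generated_by_topspace
    using \<open>0 \<in> P\<close> by (auto intro!: exI[of _ UNIV] exI[of _ "cdual_apply 0"])
  have cont: "continuous_map (wkstar_topology P) weak_topology m"
    if m: "\<And>\<xi> :: ('b, 'b) ptensor cdual cdual. \<exists>g\<in>P. \<forall>a. cdual_apply \<xi> (m a) = cdual_apply g a" for m :: "'b \<Rightarrow> ('b, 'b) ptensor cdual"
    unfolding weak_topology_def initial_topology_def continuous_on_generated_topo_iff
  proof (intro conjI allI impI)
    fix V :: "('b, 'b) ptensor cdual set" assume "V \<in> {h -` U | h U. h \<in> range cdual_apply \<and> open U}"
    then obtain \<xi> U where V: "V = cdual_apply \<xi> -` U" "open U" by auto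
    obtain g where g: "g \<in> P" "\<And>a. cdual_apply \<xi> (m a) = cdual_apply g a" using m by blast
    have "m -` V \<inter> topspace (wkstar_topology P) = cdual_apply g -` U"
      by (auto simp: V g top)
    moreover have "openin (wkstar_topology P) (cdual_apply g -` U)"
      unfolding wkstar_topology_def initial_topology_def
      using g(1) V(2) by (intro topology_generated_by_Basis) auto
    ultimately show "openin (wkstar_topology P) (m -` V \<inter> topspace (wkstar_topology P))" by simp
  qed (auto intro!: exI[of _ UNIV] exI[of _ "cdual_apply 0"])
  have eval: "\<exists>b. \<forall>g\<in>P. cdual_apply \<xi> (ptensor_mult_adjoint g) = cdual_apply g b" for \<xi> :: "('b, 'b) ptensor cdual cdual"
  proof -
    have "(\<lambda>g\<in>P. cdual_apply \<xi> (ptensor_mult_adjoint g)) \<in> dual_on P"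
      by (intro dual_on_restrict sub bounded_clinear_compose[OF bounded_clinear_cdual_apply]
          bounded_clinear_ptensor_mult_adjoint)
    then show ?thesis by (rule predual_eval_cases[OF P]) auto
  qed
  note D = dual_act[OF banach_bimodule_ptensor, folded ptensor_dual_lact_def ptensor_dual_ract_def]
  have mult: "ptensor_mult (ptensor_ract T a) = ptensor_mult T * a"
    "ptensor_mult (ptensor_lact a T) = a * ptensor_mult T" for T and a :: 'b
    by (rule fun_cong[OF bounded_clinear_ptensor_eqI];
        auto intro!: bounded_clinear_compose[OF ptensor_mult(1)] bounded_clinear_compose[OF bounded_clinear_mult(1)]
          bounded_clinear_compose[OF bounded_clinear_mult(2)] ptensor_act_tensor ptensor_mult(1)
          simp: ptensor_act_tensor ptensor_mult mult.assoc)+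
  have L: "ptensor_dual_lact a (ptensor_mult_adjoint f) = ptensor_mult_adjoint (dual_lact (*) a f)"
    and R: "ptensor_dual_ract (ptensor_mult_adjoint f) a = ptensor_mult_adjoint (dual_ract (*) f a)" for a
    by (auto intro!: cdual_eqI simp: D mult ptensor_mult_adjoint_apply dual_act_apply)
  show ?thesis
    unfolding sigma_wc_ptensor_dual_def sigma_wc_def mem_Collect_eq L R
  proof (intro conjI cont)
    fix \<xi> :: "('b, 'b) ptensor cdual cdual"
    obtain b where b: "\<forall>g\<in>P. cdual_apply \<xi> (ptensor_mult_adjoint g) = cdual_apply g b" using eval by blast
    show "\<exists>g\<in>P. \<forall>a. cdual_apply \<xi> (ptensor_mult_adjoint (dual_lact (*) a f)) = cdual_apply g a"
      using b act f by (intro bexI[of _ "dual_ract (*) f b"]) (auto simp: dual_act_apply)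
    show "\<exists>g\<in>P. \<forall>a. cdual_apply \<xi> (ptensor_mult_adjoint (dual_ract (*) f a)) = cdual_apply g a"
      using b act f by (intro bexI[of _ "dual_lact (*) b f"]) (auto simp: dual_act_apply)
  qed
qed

lemma pi_sigma_wc:
  fixes P :: "'b::{complex_normed_algebra, banach} cdual set"
  assumes P: "dual_banach_algebra P" and F: "F \<in> dual_on (sigma_wc_ptensor_dual P)" and f: "f \<in> P"
  shows "cdual_apply f (pi_sigma_wc P F) = F (ptensor_mult_adjoint f)"
proof -
  have sub: "csubspace P" using P by (auto simp: dual_banach_algebra_def)
  note ad = ptensor_mult_adjoint_sigma_wc[OF P]
  have lin: "ptensor_mult_adjoint (f + g) = ptensor_mult_adjoint f + ptensor_mult_adjoint g"
    "ptensor_mult_adjoint (c *\<^sub>C f) = c *\<^sub>C ptensor_mult_adjoint f" for f g :: "'b cdual" and c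
    by (auto intro!: cdual_eqI simp: ptensor_mult_adjoint_apply cdual_ops)
  obtain K where K: "\<And>x. x \<in> sigma_wc_ptensor_dual P \<Longrightarrow> cmod (F x) \<le> K * norm x"
    using F unfolding dual_on_def by blast
  obtain L where L: "\<And>f. norm (ptensor_mult_adjoint (f :: 'b cdual)) \<le> norm f * L"
    using bounded_linear.bounded bounded_clinear_ptensor_mult_adjoint unfolding bounded_clinear_def by blast
  have "cmod (F (ptensor_mult_adjoint g)) \<le> \<bar>K\<bar> * L * norm g" if "g \<in> P" for g
  proof -
    have "cmod (F (ptensor_mult_adjoint g)) \<le> \<bar>K\<bar> * norm (ptensor_mult_adjoint g)"
      using K[OF ad[OF that]] by (meson abs_ge_self mult_right_mono norm_ge_zero order_trans)
    also have "\<dots> \<le> \<bar>K\<bar> * (norm g * L)" by (intro mult_left_mono L) simp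
    finally show ?thesis by (simp add: mult_ac)
  qed
  then have "(\<lambda>f\<in>P. F (ptensor_mult_adjoint f)) \<in> dual_on P"
    using F sub ad by (auto simp: dual_on_def csubspace_def lin)
  moreover have R: "range (predual_eval P) = dual_on P"
    using P by (simp add: dual_banach_algebra_def bij_betw_def)
  ultimately have "predual_eval P (pi_sigma_wc P F) = (\<lambda>f\<in>P. F (ptensor_mult_adjoint f))"
    unfolding pi_sigma_wc_def by (intro f_inv_into_f) (simp only: R)
  from fun_cong[OF this, of f] f show ?thesis by (simp add: predual_eval_def)
qed

lemma left_approximate_identity_net:
  assumes "directed_set D le" "\<And>a. ((\<lambda>e. e * a) \<longlongrightarrow> a) (net_filter D le x)"
  shows "left_approximate_identity (net_filter D le x)"
  using assms by (simp add: left_approximate_identity_def net_filter_neq_bot)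

lemma approx_connes_biprojective_net:
  assumes D: "directed_set D le" and \<rho>: "\<And>i. i \<in> D \<Longrightarrow> \<rho> i \<in> connes_morphisms P"
    and lim: "\<And>a e. 0 < e \<Longrightarrow> \<exists>i\<in>D. \<forall>j\<in>D. le i j \<longrightarrow> norm (pi_sigma_wc P (\<rho> j a) - a) < e"
  shows "approx_connes_biprojective P"
  unfolding approx_connes_biprojective_def tendsto_iff dist_norm
proof (intro exI[of _ "net_filter D le \<rho>"] conjI allI impI)
  show "net_filter D le \<rho> \<noteq> bot" by (rule net_filter_neq_bot[OF D])
  obtain i where "i \<in> D" using D by (auto simp: directed_set_def)
  then show "\<forall>\<^sub>F r in net_filter D le \<rho>. r \<in> connes_morphisms P"
    unfolding eventually_net_filter[OF D] using \<rho> by blast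
  show "\<forall>\<^sub>F r in net_filter D le \<rho>. norm (pi_sigma_wc P (r a) - a) < e" if "0 < e" for a e
    unfolding eventually_net_filter[OF D] using lim[OF that] .
qed

end

theory Submission
  imports Defs
begin

text \<open>
  The weak* continuous character \<open>\<phi>\<close> lies in the predual, hence so do the functionals \<open>\<theta> t = \<phi> (t\<^sub>1\<^sub>2)\<close> and
  \<open>\<psi> t = \<phi> (t\<^sub>2\<^sub>2)\<close> on the triangular algebra, and \<open>\<theta> \<otimes> \<psi>\<close>, \<open>\<psi> \<otimes> \<psi> = \<pi>\<^sup>* \<psi>\<close> belong to the \<open>\<sigma>wc\<close>-part. Choose
  \<open>x\<close> with \<open>\<phi> x = 1\<close> and let \<open>s\<close>, \<open>a\<close> be the matrices with \<open>x\<close> in the upper right, respectively lower right,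
  corner and zeros elsewhere. Then \<open>\<theta> \<cdot> s = \<psi>\<close> and \<open>(s a) \<cdot> \<psi> = 0\<close>. For a bimodule morphism \<open>\<rho>\<close>,
  \<open>\<psi> (\<pi> (\<rho> a)) = \<rho>(a)(\<psi> \<otimes> \<psi>) = \<rho>(s a)(\<theta> \<otimes> \<psi>)\<close>, and this is the limit of
  \<open>\<rho>(e s a)(\<theta> \<otimes> \<psi>) = \<rho>(e)(\<theta> \<otimes> (s a) \<cdot> \<psi>) = 0\<close> along the diagonal left approximate identity \<open>e\<close>.
  So \<open>\<psi> (\<pi> (\<rho> a)) = 0\<close> for every \<open>\<rho>\<close>, although \<open>\<psi> a = 1\<close>.
\<close>

section \<open>Weak* continuous functionals\<close>

text \<open>Induction on \<open>F\<close>, with \<open>\<phi>\<close> generalised because it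
  changes. If \<open>f\<close> vanishes on the common kernel of \<open>F\<close>, it adds no
  constraint; otherwise a suitable multiple of \<open>f\<close> is subtracted from
  \<open>\<phi>\<close> and put back at the end.\<close>

lemma functional_in_span_kernels:
  fixes P :: "'b::complex_normed_vector cdual set"
  assumes P: "csubspace P" and "finite F" "F \<subseteq> P"
    and add: "\<And>x y. \<phi> (x + y) = \<phi> x + \<phi> y" and scale: "\<And>c x. \<phi> (c *\<^sub>C x) = c * \<phi> x"
    and ker: "\<And>x. (\<And>f. f \<in> F \<Longrightarrow> cdual_apply f x = 0) \<Longrightarrow> \<phi> x = 0"
  shows "\<exists>g\<in>P. cdual_apply g = \<phi>"
  using \<open>finite F\<close> \<open>F \<subseteq> P\<close> add scale ker
proof (induction F arbitrary: \<phi> rule: finite_induct)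
  case empty
  then show ?case
    using P by (intro bexI[of _ 0]) (auto simp: csubspace_def cdual_ops)
next
  case (insert f F)
  show ?case
  proof (cases "\<forall>x. (\<forall>g\<in>F. cdual_apply g x = 0) \<longrightarrow> cdual_apply f x = 0")
    case True
    show ?thesis
    proof (rule insert.IH)
      show "\<phi> x = 0" if "\<And>g. g \<in> F \<Longrightarrow> cdual_apply g x = 0" for x
        by (rule insert.prems(4)) (use True that in blast)
    qed (use insert.prems in auto)
  next
    case False
    then obtain y where y: "\<And>g. g \<in> F \<Longrightarrow> cdual_apply g y = 0" "cdual_apply f y \<noteq> 0"
      by blast
    \<comment> \<open>Since \<open>z\<close> is killed by \<open>F\<close> and \<open>f\<close> is 1
      there, \<open>x - f(x) z\<close> lies in the kernel of \<open>f\<close> as well as of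
      \<open>F\<close>; hence \<open>\<phi> - \<phi>(z) f\<close> vanishes on the common kernel of
      \<open>F\<close>.\<close>
    define z where "z = (1 / cdual_apply f y) *\<^sub>C y"
    have z: "\<And>g. g \<in> F \<Longrightarrow> cdual_apply g z = 0" "cdual_apply f z = 1"
      using y by (auto simp: z_def cdual_linear)
    have "\<exists>g\<in>P. cdual_apply g = (\<lambda>x. \<phi> x + (- \<phi> z) * cdual_apply f x)"
    proof (rule insert.IH)
      fix x assume x: "\<And>g. g \<in> F \<Longrightarrow> cdual_apply g x = 0"
      have "\<phi> (x + (- cdual_apply f x) *\<^sub>C z) = 0"
        by (rule insert.prems(4)) (use x z in \<open>auto simp: cdual_linear(1,2)\<close>)
      then show "\<phi> x + (- \<phi> z) * cdual_apply f x = 0"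
        by (simp add: insert.prems(2,3) mult.commute)
    qed (use insert.prems in \<open>auto simp: cdual_linear algebra_simps\<close>)
    then obtain g where g: "g \<in> P" "\<And>x. cdual_apply g x = \<phi> x + (- \<phi> z) * cdual_apply f x"
      by (auto simp: fun_eq_iff)
    show ?thesis
    proof
      show "g + \<phi> z *\<^sub>C f \<in> P"
        using P g(1) insert.prems(1) by (auto simp: csubspace_def)
      show "cdual_apply (g + \<phi> z *\<^sub>C f) = \<phi>"
        by (auto simp: cdual_ops g(2))
    qed
  qed
qed

text \<open>An open set constrains only finitely many functionals near 0. In the induction,
  intersections merge the finite sets, unions keep one of them, and a subbasic set needs just
  \<open>{f}\<close>, because \<open>f x = 0\<close> forces \<open>f x = f 0\<close>.\<close>

lemma openin_wkstar_contains_kernels: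
  assumes "openin (wkstar_topology P) W" and "0 \<in> W"
  obtains F where "finite F" "F \<subseteq> P" "{x. \<forall>f\<in>F. cdual_apply f x = 0} \<subseteq> W"
proof -
  have "generate_topology_on {h -` U | h U. h \<in> cdual_apply ` P \<and> open U} W"
    using assms(1) by (simp add: wkstar_topology_def initial_topology_def openin_topology_generated_by_iff)
  then have "0 \<in> W \<longrightarrow> (\<exists>F. finite F \<and> F \<subseteq> P \<and> {x. \<forall>f\<in>F. cdual_apply f x = 0} \<subseteq> W)"
  proof induction
    case Empty
    then show ?case by simp
  next
    case (Int V W)
    show ?case
    proof
      assume "0 \<in> V \<inter> W"
      then obtain F G where "finite F" "F \<subseteq> P" "{x. \<forall>f\<in>F. cdual_apply f x = 0} \<subseteq> V"
        "finite G" "G \<subseteq> P" "{x. \<forall>f\<in>G. cdual_apply f x = 0} \<subseteq> W"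
        using Int.IH by auto
      then show "\<exists>F. finite F \<and> F \<subseteq> P \<and> {x. \<forall>f\<in>F. cdual_apply f x = 0} \<subseteq> V \<inter> W"
        by (intro exI[of _ "F \<union> G"]) auto
    qed
  next
    case (UN K)
    then show ?case by (meson UnionE Union_upper order_trans)
  next
    case (Basis s)
    then obtain f U where f: "f \<in> P" "s = cdual_apply f -` U" by auto
    show ?case
      using f by (intro impI exI[of _ "{f}"]) (auto simp: cdual_linear)
  qed
  with \<open>0 \<in> W\<close> that show thesis by blast
qed

lemma topspace_wkstar_topology:
  assumes "csubspace P" shows "topspace (wkstar_topology P) = UNIV"
  unfolding wkstar_topology_def initial_topology_def topology_generated_by_topspace
  using assms by (auto simp: csubspace_def intro!: exI[of _ UNIV])

text \<open>Some finite common kernel is mapped into the unit disc by \<open>\<phi>\<close>. It is a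
  subspace, so rescaling shows that \<open>\<phi>\<close> vanishes on it.\<close>

lemma wkstar_continuous_functional_in_predual:
  fixes P :: "'b::complex_normed_vector cdual set"
  assumes P: "csubspace P" and cont: "continuous_map (wkstar_topology P) euclidean \<phi>"
    and add: "\<And>x y. \<phi> (x + y) = \<phi> x + \<phi> y" and scale: "\<And>c x. \<phi> (c *\<^sub>C x) = c * \<phi> x"
  shows "\<exists>g\<in>P. cdual_apply g = \<phi>"
proof -
  have "openin (wkstar_topology P) (\<phi> -` ball 0 1)"
    using openin_continuous_map_preimage[OF cont, of "ball 0 1"]
    by (simp add: topspace_wkstar_topology[OF P] vimage_def)
  moreover have "0 \<in> \<phi> -` ball 0 1"
    using scale[of 0 0] by simp
  ultimately obtain F where F: "finite F" "F \<subseteq> P" "{x. \<forall>f\<in>F. cdual_apply f x = 0} \<subseteq> \<phi> -` ball 0 1"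
    by (rule openin_wkstar_contains_kernels)
  show ?thesis
  proof (rule functional_in_span_kernels[OF P F(1,2) add scale])
    fix x assume x: "\<And>f. f \<in> F \<Longrightarrow> cdual_apply f x = 0"
    show "\<phi> x = 0"
    proof (rule ccontr)
      assume nz: "\<phi> x \<noteq> 0"
      \<comment> \<open>At this multiple of \<open>x\<close> the value of \<open>\<phi>\<close> is
        1, which is outside the open ball.\<close>
      have "(1 / \<phi> x) *\<^sub>C x \<in> \<phi> -` ball 0 1"
        using x by (intro subsetD[OF F(3)]) (auto simp: cdual_linear)
      then show False using nz by (simp add: scale)
    qed
  qed
qed

lemma continuous_map_wkstar_weak:
  fixes m :: "'b::complex_normed_vector \<Rightarrow> 'e::complex_normed_vector"
  assumes P: "csubspace P"
    and m: "\<And>\<xi> :: 'e cdual. \<exists>g\<in>P. \<forall>a. cdual_apply \<xi> (m a) = cdual_apply g a"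
  shows "continuous_map (wkstar_topology P) weak_topology m"
  unfolding weak_topology_def initial_topology_def continuous_on_generated_topo_iff
proof (intro conjI allI impI)
  fix V :: "'e set" assume "V \<in> {h -` U | h U. h \<in> range cdual_apply \<and> open U}"
  then obtain \<xi> U where V: "V = cdual_apply \<xi> -` U" "open U" by auto
  obtain g where g: "g \<in> P" "\<And>a. cdual_apply \<xi> (m a) = cdual_apply g a" using m by blast
  have "m -` V \<inter> topspace (wkstar_topology P) = cdual_apply g -` U"
    by (auto simp: V g topspace_wkstar_topology[OF P])
  then show "openin (wkstar_topology P) (m -` V \<inter> topspace (wkstar_topology P))"
    using g(1) V(2) unfolding wkstar_topology_def initial_topology_def
    by (auto intro!: topology_generated_by_Basis)
qed (auto intro!: exI[of _ UNIV])


section \<open>Elementary tensors of functionals\<close>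

definition tensor_functional ::
    "'b::complex_normed_vector cdual \<Rightarrow> 'c::complex_normed_vector cdual \<Rightarrow> ('b, 'c) ptensor cdual" where
  "tensor_functional f g = to_cdual (ptensor_lift (\<lambda>x y. cdual_apply f x * cdual_apply g y))"

lemma bounded_cbilinear_cdual_times: "bounded_cbilinear (\<lambda>x y. cdual_apply f x * cdual_apply g y)"
proof (rule bounded_cbilinearI[where K="norm f * norm g"])
  show "norm (cdual_apply f x * cdual_apply g y) \<le> norm x * norm y * (norm f * norm g)" for x y
    using mult_mono[OF cdual_norm[of f x] cdual_norm[of g y]] by (simp add: norm_mult mult_ac)
qed (auto simp: cdual_linear algebra_simps scaleC_complex_def)

lemma tensor_functional_tensor: "cdual_apply (tensor_functional f g) (x \<otimes> y) = cdual_apply f x * cdual_apply g y"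
  unfolding tensor_functional_def
  by (simp add: to_cdual_apply ptensor_lift[OF bounded_cbilinear_cdual_times])

lemma norm_tensor_functional_le: "norm (tensor_functional f g) \<le> norm f * norm g"
proof (rule cdual_norm_le)
  show "cmod (cdual_apply (tensor_functional f g) T) \<le> norm f * norm g * norm T" for T
    unfolding tensor_functional_def to_cdual_apply[OF ptensor_lift(1)[OF bounded_cbilinear_cdual_times]]
  proof (rule ptensor_lift_norm[OF bounded_cbilinear_cdual_times])
    show "cmod (cdual_apply f x * cdual_apply g y) \<le> norm f * norm g * (norm x * norm y)" for x y
      using mult_mono[OF cdual_norm[of f x] cdual_norm[of g y]] by (simp add: norm_mult mult_ac)
  qed simp
qed simp

lemma ptensor_cdual_eqI:
  "(\<And>x y. cdual_apply f (x \<otimes> y) = cdual_apply g (x \<otimes> y)) \<Longrightarrow> f = g"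
  by (rule cdual_eqI, rule fun_cong[OF bounded_clinear_ptensor_eqI]) (auto simp: bounded_clinear_cdual_apply)

lemma bounded_cbilinear_tensor_functional: "bounded_cbilinear tensor_functional"
proof (rule bounded_cbilinearI[where K=1])
  show "norm (tensor_functional f g) \<le> norm f * norm g * 1" for f :: "'a cdual" and g :: "'b cdual"
    using norm_tensor_functional_le[of f g] by simp
qed (auto intro!: ptensor_cdual_eqI simp: tensor_functional_tensor cdual_ops algebra_simps)

text \<open>The left action on the dual is the transpose of right multiplication of tensors, hence
  it touches only the second factor; symmetrically for the right action.\<close>

lemma ptensor_dual_act_tensor_functional:
  fixes f g :: "'b::{complex_normed_algebra, banach} cdual"
  shows "ptensor_dual_lact a (tensor_functional f g) = tensor_functional f (dual_lact (*) a g)"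
    and "ptensor_dual_ract (tensor_functional f g) a = tensor_functional (dual_ract (*) f a) g"
  by (auto intro!: ptensor_cdual_eqI simp: tensor_functional_tensor dual_act_apply ptensor_act_tensor
      dual_act[OF banach_bimodule_ptensor, folded ptensor_dual_lact_def ptensor_dual_ract_def])

text \<open>For \<open>\<xi>\<close> in the bidual, \<open>k \<mapsto> \<xi>(f \<otimes> k)\<close>
  is bounded on the predual, hence evaluation at some \<open>b\<close>. Then
  \<open>\<xi>(f \<otimes> a \<cdot> g) = g(b a) = (g \<cdot> b)(a)\<close>, and
  \<open>g \<cdot> b\<close> is again in \<open>P\<close>. The first factor is treated in the same
  way.\<close>

lemma tensor_functional_sigma_wc:
  fixes P :: "'b::{complex_normed_algebra, banach} cdual set"
  assumes P: "dual_banach_algebra P" and f: "f \<in> P" and g: "g \<in> P"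
  shows "tensor_functional f g \<in> sigma_wc_ptensor_dual P"
proof -
  have sub: "csubspace P" and act: "\<And>a f. f \<in> P \<Longrightarrow> dual_lact (*) a f \<in> P \<and> dual_ract (*) f a \<in> P"
    using P by (auto simp: dual_banach_algebra_def)
  have eval: "\<exists>b. \<forall>k\<in>P. cdual_apply \<xi> (E k) = cdual_apply k b"
    if "bounded_clinear E" for \<xi> :: "('b, 'b) ptensor cdual cdual" and E
  proof -
    have "(\<lambda>k\<in>P. cdual_apply \<xi> (E k)) \<in> dual_on P"
      by (intro dual_on_restrict sub bounded_clinear_compose[OF bounded_clinear_cdual_apply] that)
    then show ?thesis by (rule predual_eval_cases[OF P]) auto
  qed
  note B = bounded_cbilinear_ops(5,6)[OF bounded_cbilinear_tensor_functional]
  show ?thesis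
    unfolding sigma_wc_ptensor_dual_def sigma_wc_def mem_Collect_eq ptensor_dual_act_tensor_functional
  proof (intro conjI continuous_map_wkstar_weak sub)
    fix \<xi> :: "('b, 'b) ptensor cdual cdual"
    obtain b where b: "\<forall>k\<in>P. cdual_apply \<xi> (tensor_functional f k) = cdual_apply k b"
      using eval[OF B(1)[of f]] by blast
    show "\<exists>k\<in>P. \<forall>a. cdual_apply \<xi> (tensor_functional f (dual_lact (*) a g)) = cdual_apply k a"
      using b act g by (intro bexI[of _ "dual_ract (*) g b"]) (auto simp: dual_act_apply)
    obtain c where c: "\<forall>k\<in>P. cdual_apply \<xi> (tensor_functional k g) = cdual_apply k c"
      using eval[OF B(2)[of g]] by blast
    show "\<exists>k\<in>P. \<forall>a. cdual_apply \<xi> (tensor_functional (dual_ract (*) f a) g) = cdual_apply k a"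
      using c act f by (intro bexI[of _ "dual_lact (*) c f"]) (auto simp: dual_act_apply)
  qed
qed

lemma ptensor_mult_adjoint_character:
  fixes f :: "'b::{complex_normed_algebra, banach} cdual"
  assumes "\<And>x y. cdual_apply f (x * y) = cdual_apply f x * cdual_apply f y"
  shows "ptensor_mult_adjoint f = tensor_functional f f"
  by (rule ptensor_cdual_eqI) (simp add: ptensor_mult_adjoint_apply ptensor_mult tensor_functional_tensor assms)


section \<open>Connes morphisms\<close>

text \<open>Boundedness of \<open>F\<close> makes the supremum genuine. At \<open>x = 0\<close> the
  quotient says nothing, and the bound by \<open>K\<close> gives \<open>F 0 = 0\<close>.\<close>

lemma dual_on_norm_bound:
  assumes "F \<in> dual_on S" and "x \<in> S"
  shows "cmod (F x) \<le> dual_on_norm S F * norm x"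
proof -
  obtain K where K: "\<And>y. y \<in> S \<Longrightarrow> cmod (F y) \<le> K * norm y"
    using assms(1) unfolding dual_on_def by blast
  have "cmod (F y) / norm y \<le> \<bar>K\<bar>" if "y \<in> S" for y
    using order_trans[OF K[OF that] mult_right_mono[OF abs_ge_self[of K] norm_ge_zero[of y]]]
    by (cases "y = 0") (auto simp: field_simps)
  then have "cmod (F x) / norm x \<le> dual_on_norm S F"
    unfolding dual_on_norm_def using assms(2) by (intro cSUP_upper bdd_aboveI2)
  then show ?thesis
    using K[OF assms(2)] by (cases "x = 0") (auto simp: field_simps)
qed

lemma connes_morphism_act:
  assumes "\<rho> \<in> connes_morphisms P" and "x \<in> sigma_wc_ptensor_dual P"
  shows "\<rho> (a * b) x = \<rho> b (ptensor_dual_ract x a)" and "\<rho> (a * b) x = \<rho> a (ptensor_dual_lact b x)"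
proof -
  let ?S = "sigma_wc_ptensor_dual P"
  have "\<rho> (a * b) = dual_on_lact ?S ptensor_dual_ract a (\<rho> b)"
    "\<rho> (a * b) = dual_on_ract ?S ptensor_dual_lact (\<rho> a) b"
    using assms(1) unfolding connes_morphisms_def Let_def by blast+
  from this[THEN fun_cong, of x] assms(2)
  show "\<rho> (a * b) x = \<rho> b (ptensor_dual_ract x a)" "\<rho> (a * b) x = \<rho> a (ptensor_dual_lact b x)"
    by (simp_all add: dual_on_lact_def dual_on_ract_def)
qed

text \<open>Norm continuity in the algebra variable, needed to pass to the limit along the
  approximate identity after evaluating at a fixed \<open>x\<close>.\<close>

lemma connes_morphism_bounded_linear:
  assumes "\<rho> \<in> connes_morphisms P" and x: "x \<in> sigma_wc_ptensor_dual P"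
  shows "bounded_linear (\<lambda>a. \<rho> a x)"
proof -
  let ?S = "sigma_wc_ptensor_dual P"
  have dual: "\<And>a. \<rho> a \<in> dual_on ?S" and add: "\<And>a b. \<rho> (a + b) x = \<rho> a x + \<rho> b x"
    and scale: "\<And>c a. \<rho> (c *\<^sub>C a) x = c * \<rho> a x"
    using assms unfolding connes_morphisms_def Let_def by auto
  obtain K where K: "\<And>a. dual_on_norm ?S (\<rho> a) \<le> K * norm a"
    using assms unfolding connes_morphisms_def Let_def by auto
  show ?thesis
  proof (rule bounded_linear_intro[OF add])
    show "\<rho> (r *\<^sub>R a) x = r *\<^sub>R \<rho> a x" for r a
      using scale[of "complex_of_real r" a] by (simp add: scaleC_of_real scaleR_conv_of_real)
    show "cmod (\<rho> a x) \<le> norm a * (K * norm x)" for a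
      using order_trans[OF dual_on_norm_bound[OF dual x] mult_right_mono[OF K norm_ge_zero]]
      by (simp add: mult_ac)
  qed
qed

section \<open>Vanishing along an approximate identity, and the contradiction\<close>

lemma left_approximate_identity_tri:
  assumes "left_approximate_identity \<E>"
  shows "left_approximate_identity (filtermap (\<lambda>e. Tri e 0 e) \<E>)"
proof -
  have lim: "((\<lambda>e. e * a) \<longlongrightarrow> a) \<E>" for a
    using assms by (simp add: left_approximate_identity_def)
  have "((\<lambda>e. Tri e 0 e * t) \<longlongrightarrow> t) \<E>" for t
  proof (rule LIM_zero_cancel, rule tendsto_norm_zero_cancel)
    have "((\<lambda>e. norm (e * tri_11 t - tri_11 t) + norm (e * tri_12 t - tri_12 t)
        + norm (e * tri_22 t - tri_22 t)) \<longlongrightarrow> 0 + 0 + 0) \<E>"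
      by (intro tendsto_add tendsto_norm_zero LIM_zero lim)
    then show "((\<lambda>e. norm (Tri e 0 e * t - t)) \<longlongrightarrow> 0) \<E>"
      by (simp add: tri_ops)
  qed
  with assms show ?thesis
    by (simp add: left_approximate_identity_def filterlim_filtermap filtermap_bot_iff)
qed

text \<open>Two ways of moving \<open>s\<close> out of \<open>\<rho> (s * a)\<close> collide: to the
  left it turns \<open>\<theta> \<otimes> \<psi>\<close> into
  \<open>\<psi> \<otimes> \<psi>\<close>; to the right, together with \<open>a\<close> and behind
  \<open>e\<close>, it annihilates \<open>\<psi>\<close>.\<close>

lemma connes_morphism_mult_adjoint_eq_0:
  fixes Q :: "'b::{complex_normed_algebra, banach} cdual set" and \<E> :: "'b filter"
  assumes Q: "dual_banach_algebra Q" and E: "left_approximate_identity \<E>"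
    and \<rho>: "\<rho> \<in> connes_morphisms Q" and \<theta>: "\<theta> \<in> Q" and \<psi>: "\<psi> \<in> Q"
    and mult: "\<And>x y. cdual_apply \<psi> (x * y) = cdual_apply \<psi> x * cdual_apply \<psi> y"
    and s: "dual_ract (*) \<theta> s = \<psi>" "cdual_apply \<psi> s = 0"
  shows "cdual_apply \<psi> (pi_sigma_wc Q (\<rho> a)) = 0"
proof -
  define T where "T = tensor_functional \<theta> \<psi>"
  have T: "T \<in> sigma_wc_ptensor_dual Q"
    unfolding T_def by (rule tensor_functional_sigma_wc[OF Q \<theta> \<psi>])
  have dual: "\<rho> b \<in> dual_on (sigma_wc_ptensor_dual Q)" for b
    using \<rho> unfolding connes_morphisms_def Let_def by blast
  have "dual_lact (*) (s * a) \<psi> = 0"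
    by (rule cdual_eqI) (simp add: dual_act_apply mult s(2) cdual_ops)
  then have "ptensor_dual_lact (s * a) T = 0"
    by (auto intro!: ptensor_cdual_eqI
        simp: T_def ptensor_dual_act_tensor_functional tensor_functional_tensor cdual_ops)
  moreover have "\<rho> e 0 = 0" for e
  proof -
    \<comment> \<open>Linearity of \<open>\<rho> e\<close> is available only on the
      \<open>\<sigma>wc\<close> part, so 0 is written as a multiple of its member
      \<open>T\<close>.\<close>
    have "\<rho> e (0 *\<^sub>C T) = 0 * \<rho> e T" using dual[of e] T unfolding dual_on_def by blast
    then show ?thesis by simp
  qed
  ultimately have "\<rho> (e * (s * a)) T = 0" for e
    by (simp add: connes_morphism_act(2)[OF \<rho> T])
  moreover have "((\<lambda>e. \<rho> (e * (s * a)) T) \<longlongrightarrow> \<rho> (s * a) T) \<E>"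
    using E unfolding left_approximate_identity_def
    by (intro bounded_linear.tendsto[OF connes_morphism_bounded_linear[OF \<rho> T]]) blast
  ultimately have "\<rho> (s * a) T = 0"
    using E tendsto_const_iff[of \<E> 0 "\<rho> (s * a) T"] by (simp add: left_approximate_identity_def)
  then have "\<rho> a (tensor_functional \<psi> \<psi>) = 0"
    using connes_morphism_act(1)[OF \<rho> T, of s a]
    by (simp add: T_def ptensor_dual_act_tensor_functional s(1))
  then show ?thesis
    by (simp add: pi_sigma_wc[OF Q dual \<psi>] ptensor_mult_adjoint_character[OF mult])
qed

theorem theorem3p1:
  fixes P :: "'a::{complex_normed_algebra, banach} cdual set"
    and \<E> :: "'a filter" and \<phi> :: "'a \<Rightarrow> complex"
  assumes "dual_banach_algebra P"
    and "left_approximate_identity \<E>"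
    and "\<phi> \<in> wkstar_characters P"
  shows "\<not> approx_connes_biprojective (tri_predual P)"
proof
  assume "approx_connes_biprojective (tri_predual P)"
  then obtain \<R> where R: "\<R> \<noteq> bot" "\<forall>\<^sub>F \<rho> in \<R>. \<rho> \<in> connes_morphisms (tri_predual P)"
    "\<And>a. ((\<lambda>\<rho>. pi_sigma_wc (tri_predual P) (\<rho> a)) \<longlongrightarrow> a) \<R>"
    unfolding approx_connes_biprojective_def by blast
  have P: "csubspace P" "0 \<in> P"
    using assms(1) by (auto simp: dual_banach_algebra_def csubspace_def)
  have mult: "\<And>x y. \<phi> (x * y) = \<phi> x * \<phi> y" and scale: "\<And>c x. \<phi> (c *\<^sub>C x) = c * \<phi> x"
    using assms(3) by (auto simp: wkstar_characters_def)
  have "\<exists>f\<in>P. cdual_apply f = \<phi>"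
    using assms(3) by (intro wkstar_continuous_functional_in_predual P) (auto simp: wkstar_characters_def)
  then obtain f where f: "f \<in> P" "cdual_apply f = \<phi>" by blast
  obtain y where y: "\<phi> y \<noteq> 0"
    using assms(3) by (auto simp: wkstar_characters_def)
  define x where "x = (1 / \<phi> y) *\<^sub>C y"
  have x: "\<phi> x = 1" using y by (simp add: x_def scale)
  define \<theta> where "\<theta> = tri_functional 0 f 0"
  define \<psi> where "\<psi> = tri_functional 0 0 f"
  have mem: "\<theta> \<in> tri_predual P" "\<psi> \<in> tri_predual P"
    using f(1) P(2) unfolding \<theta>_def \<psi>_def tri_predual_def by blast+
  have app: "cdual_apply \<theta> t = \<phi> (tri_12 t)" "cdual_apply \<psi> t = \<phi> (tri_22 t)" for t
    by (simp_all add: \<theta>_def \<psi>_def tri_functional_apply cdual_ops f(2))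
  \<comment> \<open>The upper right entry of \<open>Tri 0 x 0 * t\<close> is
    \<open>x * tri_22 t\<close>, and \<open>\<phi> x = 1\<close>.\<close>
  have "dual_ract (*) \<theta> (Tri 0 x 0) = \<psi>"
    by (rule cdual_eqI) (simp add: dual_act_apply app tri_ops mult x)
  moreover have "\<phi> 0 = 0"
    using scale[of 0 0] by simp
  ultimately have "cdual_apply \<psi> (pi_sigma_wc (tri_predual P) (\<rho> a)) = 0"
    if "\<rho> \<in> connes_morphisms (tri_predual P)" for \<rho> a
    by (intro connes_morphism_mult_adjoint_eq_0[OF dual_banach_algebra_tri[OF assms(1)]
          left_approximate_identity_tri[OF assms(2)] that mem, where s="Tri 0 x 0"])
      (auto simp: app tri_ops mult)
  \<comment> \<open>The test element \<open>Tri 0 0 x\<close> is chosen so that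
    \<open>\<psi>\<close> takes the value 1 on it.\<close>
  then have "\<forall>\<^sub>F \<rho> in \<R>. cdual_apply \<psi> (pi_sigma_wc (tri_predual P) (\<rho> (Tri 0 0 x))) = 0"
    using R(2) by (auto elim: eventually_mono)
  moreover have "((\<lambda>\<rho>. cdual_apply \<psi> (pi_sigma_wc (tri_predual P) (\<rho> (Tri 0 0 x))))
      \<longlongrightarrow> cdual_apply \<psi> (Tri 0 0 x)) \<R>"
    using bounded_clinear_cdual_apply[of \<psi>] unfolding bounded_clinear_def
    by (intro bounded_linear.tendsto[OF _ R(3)]) blast
  ultimately have "((\<lambda>\<rho>. 0) \<longlongrightarrow> cdual_apply \<psi> (Tri 0 0 x)) \<R>"
    by (rule tendsto_cong[THEN iffD1])
  then show False
    using R(1) by (simp add: app x tendsto_const_iff)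
qed

end
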